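(* Consider the von Mises flat model with parameters $(N,K,\kappa)$, where $K=K_N$ and $\kappa=\kappa_N$ may depend on $N$ and asymptotics are as $N\to\infty$. For $\tau\in(0,1)$ (possibly depending on $N$) define $$p_\kappa(\tau)=\Pr\{\mathrm{vonMises}(0,\kappa)\in[-\pi\tau,\pi\tau]\},\qquad g=K\big(p_\kappa(\tau)-\tau\big).$$ (a) (Achievability) Suppose there exist sequences $c_N\to\infty$ and $\gamma_N$ with $$\gamma_N=N\tau+g-c_N\sqrt{N\tau+g},\qquad \gamma_N\ge 1+(N-1)\tau\ \text{ for all sufficiently large }N,$$ such that $$\frac{g^2}{N\tau+g}\to\infty\qquad\text{and}\qquad \frac{\big(g-c_N\sqrt{N\tau+g}\big)^2}{2N\tau+g-c_N\sqrt{N\tau+g}}-\log N\to\infty .$$ Then the interval test with window length $2\pi\tau$ and threshold $\gamma_N$ achieves strong detection. (b) (Converse) Let $R(\kappa)=I_0(2\kappa)/I_0^2(\kappa)$. If $$\frac{K^2}{N}\big(R(\kappa)-1\big)-\log R(\kappa)\to-\infty,$$ then weak detection is impossible.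
   Context: $I_0(\kappa)=\frac1{2\pi}\int_0^{2\pi}e^{\kappa\cos u}\,du$ is the modified Bessel function of the first kind of order $0$. $\mathrm{vonMises}(\Theta,\kappa)$ ($\kappa>0$) is the distribution on the circle (angles modulo $2\pi$) with density $\frac{1}{2\pi I_0(\kappa)}\exp(\kappa\cos(\theta-\Theta))$. Von Mises flat model $(N,K,\kappa)$, with $1\le K\le N$ an integer and $\kappa>0$: angles $X=(X_1,\dots,X_N)\in[0,2\pi)^N$ are observed. Under $H_0$ (law $\mathbb{Q}$) the $X_i$ are i.i.d. uniform on $[0,2\pi)$. Under $H_1$ (law $\mathbb{P}$), a subset $S^*\subset[N]$ is drawn uniformly at random among subsets of size $K$, a phase $\Theta^*$ is drawn independently and uniformly on $[0,2\pi)$, and given $(S^*,\Theta^* )$ the $X_i$ are independent with $X_i\sim\mathrm{vonMises}(\Theta^*,\kappa)$ for $i\in S^*$ and $X_i$ uniform on $[0,2\pi)$ for $i\notin S^*$. $\mathbb{P}$ is the resulting mixture law of $X$. All arcs are understood modulo $2\pi$. A test is a measurable function $\phi$ of the data with values in $\{0,1\}$ ($1$ means reject $H_0$). $p_{\mathrm{fa}}(\phi)=\mathbb{Q}\{\phi(X)=1\}$ and $p_{\mathrm{miss}}(\phi)=\mathbb{P}\{\phi(X)=0\}$. A sequence of tests achieves strong detection if both $p_{\mathrm{fa}}\to0$ and $p_{\mathrm{miss}}\to0$. Weak detection is impossible if every sequence of tests satisfies $p_{\mathrm{fa}}+p_{\mathrm{miss}}\ge 1-o(1)$; equivalently the total variation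 distance between $\mathbb{P}$ and $\mathbb{Q}$ tends to $0$. Interval test with window length $2\pi\tau$ and threshold $\gamma$: reject $H_0$ if and only if $\sup_{\theta\in[0,2\pi)}\sum_{i=1}^N\mathbf{1}\{X_i\in[\theta,\theta+2\pi\tau]\}\ge\gamma$. $\log$ is the natural logarithm. *)

theory Defs
  imports "HOL-Probability.Probability"
begin

definition bessel_I0 :: "real \<Rightarrow> real" where
  "bessel_I0 \<kappa> = (LBINT u:{0..2*pi}. exp (\<kappa> * cos u)) / (2 * pi)"

text \<open>Angles are represented in \<open>{0..<2*pi}\<close>; both circular laws are measures on the Borel
  sets of the real line that are concentrated on this fundamental domain.\<close>

definition uniform_angle :: "real measure" where
  "uniform_angle = uniform_measure lborel {0..<2*pi}"

definition von_mises :: "real \<Rightarrow> real \<Rightarrow> real measure" where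
  "von_mises \<Theta> \<kappa> = density lborel (\<lambda>\<theta>. ennreal (indicator {0..<2*pi} \<theta> *
     (exp (\<kappa> * cos (\<theta> - \<Theta>)) / (2 * pi * bessel_I0 \<kappa>))))"

definition null_law :: "nat \<Rightarrow> (nat \<Rightarrow> real) measure" where
  "null_law N = Pi\<^sub>M {1..N} (\<lambda>_. uniform_angle)"

definition conditional_law :: "nat \<Rightarrow> real \<Rightarrow> nat set \<Rightarrow> real \<Rightarrow> (nat \<Rightarrow> real) measure" where
  "conditional_law N \<kappa> S \<Theta> = Pi\<^sub>M {1..N} (\<lambda>i. if i \<in> S then von_mises \<Theta> \<kappa> else uniform_angle)"

definition latent_prior :: "nat \<Rightarrow> nat \<Rightarrow> (nat set \<times> real) measure" where
  "latent_prior N K =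
     measure_pmf (pmf_of_set {S. S \<subseteq> {1..N} \<and> card S = K}) \<Otimes>\<^sub>M uniform_angle"

definition planted_law :: "nat \<Rightarrow> nat \<Rightarrow> real \<Rightarrow> (nat \<Rightarrow> real) measure" where
  "planted_law N K \<kappa> = bind (latent_prior N K) (\<lambda>(S, \<Theta>). conditional_law N \<kappa> S \<Theta>)"

text \<open>A test returns \<open>True\<close> to reject the null hypothesis.\<close>

definition is_test :: "nat \<Rightarrow> ((nat \<Rightarrow> real) \<Rightarrow> bool) \<Rightarrow> bool" where
  "is_test N \<phi> \<longleftrightarrow> \<phi> \<in> measurable (Pi\<^sub>M {1..N} (\<lambda>_. borel)) (count_space UNIV)"

definition p_fa :: "nat \<Rightarrow> ((nat \<Rightarrow> real) \<Rightarrow> bool) \<Rightarrow> real" where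
  "p_fa N \<phi> = measure (null_law N) {X \<in> space (null_law N). \<phi> X}"

definition p_miss :: "nat \<Rightarrow> nat \<Rightarrow> real \<Rightarrow> ((nat \<Rightarrow> real) \<Rightarrow> bool) \<Rightarrow> real" where
  "p_miss N K \<kappa> \<phi> = measure (planted_law N K \<kappa>) {X \<in> space (planted_law N K \<kappa>). \<not> \<phi> X}"

text \<open>The model only exists for \<open>1 \<le> K N \<le> N\<close>, so sequences are indexed by \<open>N \<ge> 1\<close>.\<close>

definition strong_detection ::
  "(nat \<Rightarrow> nat) \<Rightarrow> (nat \<Rightarrow> real) \<Rightarrow> (nat \<Rightarrow> (nat \<Rightarrow> real) \<Rightarrow> bool) \<Rightarrow> bool" where
  "strong_detection K \<kappa> \<phi> \<longleftrightarrow>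
     (\<forall>N\<ge>1. is_test N (\<phi> N)) \<and>
     (\<lambda>N. p_fa N (\<phi> N)) \<longlonglongrightarrow> 0 \<and>
     (\<lambda>N. p_miss N (K N) (\<kappa> N) (\<phi> N)) \<longlonglongrightarrow> 0"

definition weak_detection_impossible :: "(nat \<Rightarrow> nat) \<Rightarrow> (nat \<Rightarrow> real) \<Rightarrow> bool" where
  "weak_detection_impossible K \<kappa> \<longleftrightarrow>
     (\<forall>\<phi>. (\<forall>N\<ge>1. is_test N (\<phi> N)) \<longrightarrow>
       (\<exists>\<epsilon>. \<epsilon> \<longlonglongrightarrow> 0 \<and>
         (\<forall>N\<ge>1. p_fa N (\<phi> N) + p_miss N (K N) (\<kappa> N) (\<phi> N) \<ge> 1 - \<epsilon> N)))"

text \<open>Closed arc from \<open>a\<close> to \<open>b\<close>, modulo \<open>2*pi\<close>.\<close>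

definition arc :: "real \<Rightarrow> real \<Rightarrow> real set" where
  "arc a b = {x. \<exists>k::int. x + 2 * pi * of_int k \<in> {a..b}}"

definition interval_test :: "nat \<Rightarrow> real \<Rightarrow> real \<Rightarrow> (nat \<Rightarrow> real) \<Rightarrow> bool" where
  "interval_test N \<tau> \<gamma> X \<longleftrightarrow>
     (SUP \<theta>\<in>{0..<2*pi}. \<Sum>i=1..N. indicator (arc \<theta> (\<theta> + 2 * pi * \<tau>)) (X i)) \<ge> \<gamma>"

definition arc_prob :: "real \<Rightarrow> real \<Rightarrow> real" where
  "arc_prob \<kappa> \<tau> = measure (von_mises 0 \<kappa>) (arc (- pi * \<tau>) (pi * \<tau>))"

definition bessel_ratio :: "real \<Rightarrow> real" where
  "bessel_ratio \<kappa> = bessel_I0 (2 * \<kappa>) / (bessel_I0 \<kappa>)\<^sup>2"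

end

theory Submission
  imports Defs
begin

text \<open>
  Achievability. The largest count over all arcs of length \<open>2*pi*\<tau>\<close> is attained by an arc that
  starts at a data point (\<open>interval_test_iff_anchored\<close>). Under the null law, a union bound over
  the \<open>N\<close> possible anchors therefore suffices: given the anchor, the remaining \<open>N - 1\<close>
  angles hit its arc independently with probability \<open>\<tau>\<close>, and Chernoff's bound gives a false
  alarm probability of at most \<open>N * exp (- t\<^sup>2 / (2 * \<mu> + t))\<close>, where \<open>\<mu> = (N - 1) * \<tau>\<close>
  and \<open>t\<close> is the excess of the threshold over \<open>1 + \<mu>\<close>. Up to a bounded term in the
  exponent this is the quantity assumed to vanish (\<open>p_fa_interval_test_le_exp\<close>). Under the planted
  law, the arc centred at the true phase captures a sum of independent indicators with mean
  \<open>m = N * \<tau> + g\<close>. The threshold lies \<open>c * sqrt m\<close> below the mean, so the lower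
  Chernoff tail bounds the miss probability by \<open>exp (- c\<^sup>2 / 2)\<close> (\<open>p_miss_interval_test_le\<close>).

  Converse. The planted law has a density with respect to the null law, the likelihood ratio averaged
  over the hidden subset and phase (\<open>planted_law_density\<close>). By the second moment method
  (\<open>testing_error_ge_second_moment\<close>) it suffices that the second moment of this density tends to
  \<open>1\<close>. It equals the average of \<open>\<rho> ^ m\<close> over two independent copies of the hidden
  variables, where \<open>m\<close> is the size of the overlap of the subsets and \<open>\<rho>\<close> the correlation
  of the von Mises likelihood ratios for the two phases. The correlation has mean \<open>1\<close> over the
  phase and is at most the Bessel ratio \<open>R\<close>, so averaging \<open>\<rho> ^ m\<close> over the phase gives
  at most \<open>R ^ (m - 1)\<close> if \<open>m \<ge> 1\<close>, and \<open>1\<close> if \<open>m = 0\<close>: not knowing the phase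
  gains a factor \<open>R\<close>. The overlap of two random \<open>K\<close>-subsets satisfies
  \<open>E (R ^ m) \<le> exp (K\<^sup>2 / N * (R - 1))\<close> (\<open>sum_power_overlap_le\<close>), so the second moment is at
  most \<open>1 + exp (K\<^sup>2 / N * (R - 1) - ln R)\<close> (\<open>second_moment_mixture_lr_le\<close>).
\<close>

section \<open>Angles modulo a full turn\<close>

lemma sets_uniform_angle [measurable_cong, simp]: "sets uniform_angle = sets borel"
  by (simp add: uniform_angle_def)

lemma space_uniform_angle [simp]: "space uniform_angle = UNIV"
  using sets_eq_imp_space_eq[OF sets_uniform_angle] by simp

lemma nn_integral_uniform_angle:
  assumes [measurable]: "f \<in> borel_measurable borel"
  shows "(\<integral>\<^sup>+x. f x \<partial>uniform_angle)
    = (\<integral>\<^sup>+x. f x * indicator {0..<2*pi} x \<partial>lborel) / ennreal (2*pi)"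
  unfolding uniform_angle_def by (subst nn_integral_uniform_measure) auto

lemma prob_space_uniform_angle: "prob_space uniform_angle"
  unfolding uniform_angle_def by (intro prob_space_uniform_measure) auto

interpretation U: prob_space uniform_angle
  by (rule prob_space_uniform_angle)

text \<open>The integral of a periodic function over a period does not depend on where the period
  starts. Reducing the shift to \<open>0 \<le> b < 2*pi\<close>, the part of the window that leaves
  \<open>{0..<2*pi}\<close> on one side re-enters on the other, one full turn later. All rotation
  invariance below comes from this lemma.\<close>

lemma nn_integral_uniform_angle_shift:
  fixes f :: "real \<Rightarrow> ennreal"
  assumes meas [measurable]: "f \<in> borel_measurable borel"
    and periodic: "\<And>x (k::int). f (x + 2*pi * of_int k) = f x"
  shows "(\<integral>\<^sup>+x. f (x - a) \<partial>uniform_angle) = (\<integral>\<^sup>+x. f x \<partial>uniform_angle)"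
proof -
  define k where "k = \<lfloor>a / (2*pi)\<rfloor>"
  define b where "b = a - 2*pi * of_int k"
  have b: "0 \<le> b" "b < 2*pi"
  proof -
    have "of_int k \<le> a / (2*pi)" "a / (2*pi) < of_int k + 1"
      unfolding k_def by linarith+
    then show "0 \<le> b" "b < 2*pi"
      unfolding b_def by (simp_all add: field_simps)
  qed
  have fb: "f (x - a) = f (x - b)" for x
    using periodic[of "x - b" "-k"] by (simp add: b_def algebra_simps)
  have "(\<integral>\<^sup>+x. f (x - a) * indicator {0..<2*pi} x \<partial>lborel)
      = (\<integral>\<^sup>+x. f (x - b) * indicator {0..<b} x + f (x - b) * indicator {b..<2*pi} x \<partial>lborel)"
    using b by (intro nn_integral_cong) (auto simp: fb indicator_def)
  also have "\<dots> = (\<integral>\<^sup>+x. f (x - b) * indicator {0..<b} x \<partial>lborel)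
      + (\<integral>\<^sup>+x. f (x - b) * indicator {b..<2*pi} x \<partial>lborel)"
    by (rule nn_integral_add) auto
  also have "(\<integral>\<^sup>+x. f (x - b) * indicator {0..<b} x \<partial>lborel)
      = (\<integral>\<^sup>+x. f x * indicator {2*pi-b..<2*pi} x \<partial>lborel)"
  proof (subst nn_integral_real_affine[where c=1 and t="b - 2*pi"], goal_cases)
    case 3
    have "f (x - 2*pi) = f x" for x
      using periodic[of x "-1"] by simp
    then show ?case
      by (auto intro!: nn_integral_cong simp: indicator_def algebra_simps)
  qed auto
  also have "(\<integral>\<^sup>+x. f (x - b) * indicator {b..<2*pi} x \<partial>lborel)
      = (\<integral>\<^sup>+x. f x * indicator {0..<2*pi-b} x \<partial>lborel)"
    by (subst nn_integral_real_affine[where c=1 and t=b])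
       (auto intro!: nn_integral_cong simp: indicator_def algebra_simps)
  also have "(\<integral>\<^sup>+x. f x * indicator {2*pi-b..<2*pi} x \<partial>lborel)
      + (\<integral>\<^sup>+x. f x * indicator {0..<2*pi-b} x \<partial>lborel)
      = (\<integral>\<^sup>+x. f x * indicator {2*pi-b..<2*pi} x + f x * indicator {0..<2*pi-b} x \<partial>lborel)"
    by (rule nn_integral_add[symmetric]) auto
  also have "\<dots> = (\<integral>\<^sup>+x. f x * indicator {0..<2*pi} x \<partial>lborel)"
    using b by (intro nn_integral_cong) (auto simp: indicator_def)
  finally show ?thesis
    by (simp add: nn_integral_uniform_angle)
qed

lemma arc_iff: "x \<in> arc a b \<longleftrightarrow> (\<exists>k::int. a \<le> x + 2*pi * of_int k \<and> x + 2*pi * of_int k \<le> b)"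
  by (simp add: arc_def)

lemma arc_periodic: "x + 2*pi * of_int k \<in> arc a b \<longleftrightarrow> x \<in> arc a b"
proof -
  have *: "y \<in> arc a b" if "y + 2*pi * of_int k \<in> arc a b" for y k
  proof -
    from that obtain l :: int where "a \<le> y + 2*pi * of_int k + 2*pi * of_int l"
      "y + 2*pi * of_int k + 2*pi * of_int l \<le> b" by (auto simp: arc_iff)
    then show ?thesis
      unfolding arc_iff by (intro exI[of _ "k + l"]) (simp add: algebra_simps)
  qed
  from *[of x k] *[of "x + 2*pi * of_int k" "-k"] show ?thesis
    by (auto simp: algebra_simps)
qed

lemma arc_shift: "x \<in> arc (t + a) (t + b) \<longleftrightarrow> x - t \<in> arc a b"
  by (auto simp: arc_iff algebra_simps)

lemma arc_shift_turns: "arc (a + 2*pi * of_int k) (b + 2*pi * of_int k) = arc a b"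
proof -
  have "x \<in> arc (2*pi * of_int k + a) (2*pi * of_int k + b) \<longleftrightarrow> x \<in> arc a b" for x
    unfolding arc_shift using arc_periodic[of x "-k"] by (simp add: algebra_simps)
  then show ?thesis by (auto simp: add.commute)
qed

lemma pred_arc [measurable (raw)]:
  assumes [measurable]: "f \<in> borel_measurable M" "a \<in> borel_measurable M" "b \<in> borel_measurable M"
  shows "Measurable.pred M (\<lambda>x. f x \<in> arc (a x) (b x))"
  unfolding arc_iff by measurable

lemma sets_arc [measurable, simp]: "arc a b \<in> sets borel"
proof -
  have "{x \<in> space borel. x \<in> arc a b} \<in> sets borel"
    by (rule predE) (rule pred_arc; simp)
  then show ?thesis by simp
qed

text \<open>After rotating the left end to \<open>0\<close>, the arc meets the fundamental domain in the plain
  interval \<open>{0..2*pi*\<tau>}\<close>: an arc shorter than a full turn admits no other integer shift.\<close>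

lemma emeasure_uniform_angle_arc:
  assumes "0 < \<tau>" "\<tau> < 1"
  shows "emeasure uniform_angle (arc a (a + 2*pi*\<tau>)) = ennreal \<tau>"
proof -
  have len: "0 < 2*pi*\<tau>" "2*pi*\<tau> < 2*pi" using assms by simp_all
  have "emeasure uniform_angle (arc a (a + 2*pi*\<tau>))
      = (\<integral>\<^sup>+x. indicator (arc 0 (2*pi*\<tau>)) (x - a) \<partial>uniform_angle)"
  proof (subst nn_integral_indicator[symmetric], simp, rule nn_integral_cong)
    show "indicator (arc a (a + 2*pi*\<tau>)) x = (indicator (arc 0 (2*pi*\<tau>)) (x - a) :: ennreal)" for x
      using arc_shift[of x a 0 "2*pi*\<tau>"] by (simp add: indicator_def)
  qed
  also have "\<dots> = (\<integral>\<^sup>+x. indicator (arc 0 (2*pi*\<tau>)) x \<partial>uniform_angle)"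
    by (rule nn_integral_uniform_angle_shift) (auto simp: indicator_def arc_periodic)
  also have "\<dots> = (\<integral>\<^sup>+x. indicator {0..2*pi*\<tau>} x \<partial>lborel) / ennreal (2*pi)"
  proof (subst nn_integral_uniform_angle, simp, rule arg_cong[where f="\<lambda>x. x / _"],
      rule nn_integral_cong)
    fix x :: real
    have "x \<in> {0..2*pi*\<tau>}" if x: "0 \<le> x" "x < 2*pi" and "x \<in> arc 0 (2*pi*\<tau>)"
    proof -
      from \<open>x \<in> arc 0 (2*pi*\<tau>)\<close> obtain k :: int where k: "0 \<le> x + 2*pi * of_int k" "x + 2*pi * of_int k \<le> 2*pi*\<tau>"
        by (auto simp: arc_iff)
      have "2*pi * of_int (-1) < 2*pi * of_int k" using x k(1) by simp
      then have "-1 < k" by (subst (asm) mult_less_cancel_left_pos) auto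
      moreover have "2*pi * of_int k < 2*pi * of_int 1" using x k(2) len(2) by linarith
      then have "k < 1" by (subst (asm) mult_less_cancel_left_pos) auto
      ultimately have "k = 0" by simp
      with k show ?thesis by simp
    qed
    moreover have "x \<in> arc 0 (2*pi*\<tau>)" if "x \<in> {0..2*pi*\<tau>}"
      using that by (auto simp: arc_iff intro!: exI[of _ 0])
    moreover have "x \<in> {0..<2*pi}" if "x \<in> {0..2*pi*\<tau>}"
    proof -
      have "0 \<le> x" "x \<le> 2*pi*\<tau>" using that by simp_all
      from this(1) le_less_trans[OF this(2) len(2)] show ?thesis by simp
    qed
    ultimately show "indicator (arc 0 (2*pi*\<tau>)) x * indicator {0..<2*pi} x
        = (indicator {0..2*pi*\<tau>} x :: ennreal)"
      by (cases "x \<in> {0..2*pi*\<tau>}") (auto simp: indicator_def)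
  qed
  also have "\<dots> = ennreal (2*pi*\<tau>) / ennreal (2*pi)"
    using len by simp
  also have "\<dots> = ennreal \<tau>"
    using assms by (simp add: divide_ennreal)
  finally show ?thesis .
qed

section \<open>The von Mises density with respect to the uniform law\<close>

definition von_mises_lr :: "real \<Rightarrow> real \<Rightarrow> real \<Rightarrow> real" where
  "von_mises_lr \<kappa> \<Theta> x = exp (\<kappa> * cos (x - \<Theta>)) / bessel_I0 \<kappa>"

lemma cos_plus_turns: "cos (x + 2*pi * of_int k) = cos x"
  by (simp add: cos_add)

lemma nn_integral_exp_cos: "(\<integral>\<^sup>+x. ennreal (exp (\<kappa> * cos x)) \<partial>uniform_angle) = ennreal (bessel_I0 \<kappa>)"
  and bessel_I0_pos: "0 < bessel_I0 \<kappa>"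
proof -
  have int: "set_integrable lborel {0..2*pi} (\<lambda>x. exp (\<kappa> * cos x))"
    by (rule borel_integrable_atLeastAtMost') (intro continuous_intros)
  have "(\<integral>\<^sup>+x. ennreal (exp (\<kappa> * cos x)) \<partial>uniform_angle)
    = (\<integral>\<^sup>+x. ennreal (exp (\<kappa> * cos x)) * indicator {0..<2*pi} x \<partial>lborel) / ennreal (2*pi)"
    by (rule nn_integral_uniform_angle) measurable
  also have "(\<integral>\<^sup>+x. ennreal (exp (\<kappa> * cos x)) * indicator {0..<2*pi} x \<partial>lborel)
    = (\<integral>\<^sup>+x. ennreal (indicator {0..2*pi} x * exp (\<kappa> * cos x)) \<partial>lborel)"
  proof (rule nn_integral_cong_AE)
    show "AE x in lborel. ennreal (exp (\<kappa> * cos x)) * indicator {0..<2*pi} x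
        = ennreal (indicator {0..2*pi} x * exp (\<kappa> * cos x))"
      using AE_lborel_singleton[of "2*pi"] by eventually_elim (auto simp: indicator_def)
  qed
  also have "\<dots> = ennreal (LBINT u:{0..2*pi}. exp (\<kappa> * cos u))"
    using int unfolding set_lebesgue_integral_def set_integrable_def
    by (subst nn_integral_eq_integral) auto
  also have "\<dots> / ennreal (2*pi) = ennreal (bessel_I0 \<kappa>)"
    unfolding bessel_I0_def
    by (rule divide_ennreal) (auto intro!: integral_nonneg_AE simp: set_lebesgue_integral_def)
  finally show 1: "(\<integral>\<^sup>+x. ennreal (exp (\<kappa> * cos x)) \<partial>uniform_angle) = ennreal (bessel_I0 \<kappa>)" .
  have "(\<integral>\<^sup>+x. ennreal (exp (-\<bar>\<kappa>\<bar>)) \<partial>uniform_angle)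
      \<le> (\<integral>\<^sup>+x. ennreal (exp (\<kappa> * cos x)) \<partial>uniform_angle)"
  proof (intro nn_integral_mono ennreal_leI)
    fix x
    have "\<bar>\<kappa> * cos x\<bar> \<le> \<bar>\<kappa>\<bar> * 1"
      unfolding abs_mult by (intro mult_left_mono) auto
    then show "exp (-\<bar>\<kappa>\<bar>) \<le> exp (\<kappa> * cos x)" by simp
  qed
  then have "ennreal (exp (-\<bar>\<kappa>\<bar>)) \<le> ennreal (bessel_I0 \<kappa>)"
    by (simp add: 1 U.emeasure_space_1[simplified])
  then show "0 < bessel_I0 \<kappa>"
    using ennreal_neg[of "bessel_I0 \<kappa>"] by (fastforce simp: not_less[symmetric])
qed

lemma von_mises_lr_nonneg [simp]: "0 \<le> von_mises_lr \<kappa> \<Theta> x"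
  using bessel_I0_pos[of \<kappa>] by (simp add: von_mises_lr_def)

lemma von_mises_lr_measurable [measurable (raw)]:
  assumes [measurable]: "f \<in> borel_measurable M" "g \<in> borel_measurable M"
  shows "(\<lambda>x. von_mises_lr \<kappa> (f x) (g x)) \<in> borel_measurable M"
  unfolding von_mises_lr_def by measurable

text \<open>The cosine is even, so angle and mean direction can trade places. This turns the average over a
  uniform phase into the integral of a density.\<close>

lemma von_mises_lr_sym: "von_mises_lr \<kappa> \<Theta> x = von_mises_lr \<kappa> x \<Theta>"
  unfolding von_mises_lr_def using cos_minus[of "x - \<Theta>"] by simp

lemma nn_integral_von_mises_lr: "(\<integral>\<^sup>+x. ennreal (von_mises_lr \<kappa> \<Theta> x) \<partial>uniform_angle) = 1"
proof -
  have "(\<integral>\<^sup>+x. ennreal (von_mises_lr \<kappa> 0 (x - \<Theta>)) \<partial>uniform_angle)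
      = (\<integral>\<^sup>+x. ennreal (von_mises_lr \<kappa> 0 x) \<partial>uniform_angle)"
    by (rule nn_integral_uniform_angle_shift) (simp_all add: von_mises_lr_def cos_plus_turns)
  also have "\<dots> = (\<integral>\<^sup>+x. ennreal (1 / bessel_I0 \<kappa>) * ennreal (exp (\<kappa> * cos x)) \<partial>uniform_angle)"
    using bessel_I0_pos[of \<kappa>] by (simp add: von_mises_lr_def ennreal_mult[symmetric])
  also have "\<dots> = ennreal (1 / bessel_I0 \<kappa>) * ennreal (bessel_I0 \<kappa>)"
    by (subst nn_integral_cmult) (simp_all add: nn_integral_exp_cos)
  also have "\<dots> = 1"
    using bessel_I0_pos[of \<kappa>] by (simp add: ennreal_mult[symmetric])
  finally show ?thesis by (simp add: von_mises_lr_def)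
qed

lemma von_mises_density: "von_mises \<Theta> \<kappa> = density uniform_angle (\<lambda>x. ennreal (von_mises_lr \<kappa> \<Theta> x))"
proof -
  have "density uniform_angle (\<lambda>x. ennreal (von_mises_lr \<kappa> \<Theta> x))
      = density lborel (\<lambda>x. indicator {0..<2*pi} x / ennreal (2*pi) * ennreal (von_mises_lr \<kappa> \<Theta> x))"
    unfolding uniform_angle_def uniform_measure_def
    by (subst density_density_eq) auto
  also have "\<dots> = von_mises \<Theta> \<kappa>"
    unfolding von_mises_def
    by (intro arg_cong[where f="density lborel"] ext)
       (auto simp: indicator_def von_mises_lr_def divide_ennreal ennreal_mult[symmetric]
          bessel_I0_pos less_imp_le field_simps simp flip: ennreal_1)
  finally show ?thesis ..
qed

lemma sets_von_mises [measurable_cong, simp]: "sets (von_mises \<Theta> \<kappa>) = sets borel"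
  by (simp add: von_mises_def)

lemma prob_space_von_mises: "prob_space (von_mises \<Theta> \<kappa>)"
  unfolding von_mises_density
  by (rule prob_spaceI) (simp add: emeasure_density nn_integral_von_mises_lr)

text \<open>Centred at the true phase, the arc captures a von Mises angle with the same probability whatever
  the phase is; this is why the miss probability can be bounded conditionally on the phase.\<close>

lemma emeasure_von_mises_arc:
  "emeasure (von_mises \<Theta> \<kappa>) (arc (\<Theta> - pi*\<tau>) (\<Theta> + pi*\<tau>)) = ennreal (arc_prob \<kappa> \<tau>)"
proof -
  interpret V: prob_space "von_mises 0 \<kappa>" by (rule prob_space_von_mises)
  have "emeasure (von_mises \<Theta> \<kappa>) (arc (\<Theta> - pi*\<tau>) (\<Theta> + pi*\<tau>))
      = (\<integral>\<^sup>+x. ennreal (von_mises_lr \<kappa> 0 (x - \<Theta>)) * indicator (arc (-pi*\<tau>) (pi*\<tau>)) (x - \<Theta>) \<partial>uniform_angle)"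
    using arc_shift[of _ \<Theta> "-pi*\<tau>" "pi*\<tau>"] unfolding von_mises_density
    by (subst emeasure_density) (auto intro!: nn_integral_cong simp: indicator_def von_mises_lr_def)
  also have "\<dots> = (\<integral>\<^sup>+x. ennreal (von_mises_lr \<kappa> 0 x) * indicator (arc (-pi*\<tau>) (pi*\<tau>)) x \<partial>uniform_angle)"
    by (rule nn_integral_uniform_angle_shift)
       (simp_all add: von_mises_lr_def cos_plus_turns indicator_def arc_periodic)
  also have "\<dots> = emeasure (von_mises 0 \<kappa>) (arc (-pi*\<tau>) (pi*\<tau>))"
    unfolding von_mises_density by (subst emeasure_density) auto
  finally show ?thesis by (simp add: arc_prob_def V.emeasure_eq_measure)
qed

section \<open>Chernoff bounds for independent hits\<close>

text \<open>This bound turns the exact Chernoff exponent \<open>(1 + x) * ln (1 + x) - x\<close> into the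
  Bernstein-type \<open>x\<^sup>2 / (2 + x)\<close>, which agrees with it to second order at \<open>0\<close>.
  The difference of the two sides below vanishes at \<open>0\<close> and has the nonnegative derivative
  \<open>y\<^sup>2 / ((1 + y) * (2 + y)\<^sup>2)\<close>.\<close>

lemma ln_one_plus_lower_bound_rational:
  fixes x :: real
  assumes "0 \<le> x"
  shows "2 * x / (2 + x) \<le> ln (1 + x)"
proof -
  have "ln (1 + 0) - 2 * 0 / (2 + 0) \<le> ln (1 + x) - 2 * x / (2 + x)"
  proof (rule DERIV_nonneg_imp_nondecreasing[OF assms])
    fix y :: real assume y: "0 \<le> y" "y \<le> x"
    have "((\<lambda>x. ln (1 + x) - 2 * x / (2 + x)) has_real_derivative
        (1 / (1 + y) - (2 * (2 + y) - 2 * y) / (2 + y)\<^sup>2)) (at y)"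
      using y by (auto intro!: derivative_eq_intros simp: power2_eq_square)
    moreover have "1 / (1 + y) - (2 * (2 + y) - 2 * y) / (2 + y)\<^sup>2 = y\<^sup>2 / ((1 + y) * (2 + y)\<^sup>2)"
      using y by (simp add: divide_simps) (simp add: power2_eq_square algebra_simps)
    then have "0 \<le> 1 / (1 + y) - (2 * (2 + y) - 2 * y) / (2 + y)\<^sup>2"
      using y by simp
    ultimately show "\<exists>z. ((\<lambda>x. ln (1 + x) - 2 * x / (2 + x)) has_real_derivative z) (at y) \<and> 0 \<le> z"
      by blast
  qed
  then show ?thesis by simp
qed

lemma exp_minus_upper_bound_quadratic:
  fixes x :: real
  assumes "0 \<le> x"
  shows "exp (-x) \<le> 1 - x + x\<^sup>2 / 2"
proof -
  have "1 - 0 + 0\<^sup>2 / 2 - exp (-0) \<le> 1 - x + x\<^sup>2 / 2 - exp (-x)"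
  proof (rule DERIV_nonneg_imp_nondecreasing[OF assms])
    fix y :: real
    have "((\<lambda>x. 1 - x + x\<^sup>2 / 2 - exp (-x)) has_real_derivative (-1 + y + exp (-y))) (at y)"
      by (auto intro!: derivative_eq_intros)
    moreover have "0 \<le> -1 + y + exp (-y)"
      using exp_ge_add_one_self[of "-y"] by simp
    ultimately show "\<exists>z. ((\<lambda>x. 1 - x + x\<^sup>2 / 2 - exp (-x)) has_real_derivative z) (at y) \<and> 0 \<le> z"
      by blast
  qed
  then show ?thesis by simp
qed

text \<open>Each independent coordinate \<open>i\<close> is checked against its own set \<open>A i\<close>. The
  number of hits is a sum of independent, not identically distributed indicators, as needed for a
  sample that mixes uniform and von Mises angles.\<close>

locale independent_hits =
  fixes I :: "'i set" and M :: "'i \<Rightarrow> 'a measure" and A :: "'i \<Rightarrow> 'a set"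
  assumes finite_index [simp]: "finite I"
    and prob_space_components: "\<And>i. prob_space (M i)"
    and sets_hit [measurable]: "\<And>i. A i \<in> sets (M i)"
begin

sublocale product_prob_space M
  by (simp add: product_prob_spaceI prob_space_components)

definition hits :: "('i \<Rightarrow> 'a) \<Rightarrow> real" where
  "hits X = (\<Sum>i\<in>I. indicator (A i) (X i))"

definition mean_hits :: real where
  "mean_hits = (\<Sum>i\<in>I. measure (M i) (A i))"

lemma measurable_hits [measurable]: "hits \<in> borel_measurable (Pi\<^sub>M I M)"
  unfolding hits_def by measurable

text \<open>The exponential factorises over the coordinates, and a single factor is
  \<open>1 + (exp l - 1) * p\<close>, at most the corresponding factor of a Poisson variable. Hence the
  bound depends on the hit probabilities only through their sum.\<close>

lemma nn_integral_exp_hits_le: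
  "(\<integral>\<^sup>+X. ennreal (exp (l * hits X)) \<partial>Pi\<^sub>M I M) \<le> ennreal (exp ((exp l - 1) * mean_hits))"
proof -
  have prod_form: "ennreal (exp (l * hits X)) = (\<Prod>i\<in>I. ennreal (exp (l * indicator (A i) (X i))))" for X
    unfolding hits_def sum_distrib_left exp_sum[OF finite_index] by (rule prod_ennreal[symmetric]) simp
  have one: "(\<integral>\<^sup>+x. ennreal (exp (l * indicator (A i) x)) \<partial>M i)
      \<le> ennreal (exp ((exp l - 1) * measure (M i) (A i)))" for i
  proof -
    have "(\<integral>\<^sup>+x. ennreal (exp (l * indicator (A i) x)) \<partial>M i)
        = (\<integral>\<^sup>+x. ennreal (exp l) * indicator (A i) x + indicator (space (M i) - A i) x \<partial>M i)"
      by (intro nn_integral_cong) (auto simp: indicator_def)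
    also have "\<dots> = ennreal (exp l) * emeasure (M i) (A i) + emeasure (M i) (space (M i) - A i)"
      by (subst nn_integral_add) (auto simp: nn_integral_cmult_indicator)
    also have "\<dots> = ennreal (exp l * measure (M i) (A i) + (1 - measure (M i) (A i)))"
      by (simp add: M.emeasure_eq_measure M.prob_compl ennreal_mult'[symmetric] ennreal_plus[symmetric]
          del: ennreal_plus)
    also have "\<dots> \<le> ennreal (exp ((exp l - 1) * measure (M i) (A i)))"
      using exp_ge_add_one_self[of "(exp l - 1) * measure (M i) (A i)"]
      by (intro ennreal_leI) (simp add: algebra_simps)
    finally show ?thesis .
  qed
  have "(\<integral>\<^sup>+X. ennreal (exp (l * hits X)) \<partial>Pi\<^sub>M I M)
      = (\<integral>\<^sup>+X. (\<Prod>i\<in>I. ennreal (exp (l * indicator (A i) (X i)))) \<partial>Pi\<^sub>M I M)"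
    by (simp only: prod_form)
  also have "\<dots> = (\<Prod>i\<in>I. \<integral>\<^sup>+x. ennreal (exp (l * indicator (A i) x)) \<partial>M i)"
    by (rule product_nn_integral_prod) auto
  also have "\<dots> \<le> (\<Prod>i\<in>I. ennreal (exp ((exp l - 1) * measure (M i) (A i))))"
    by (intro prod_mono_ennreal one)
  also have "\<dots> = ennreal (exp ((exp l - 1) * mean_hits))"
    by (simp add: mean_hits_def sum_distrib_left exp_sum prod_ennreal)
  finally show ?thesis .
qed

text \<open>Multiplying the inequality by \<open>l\<close> covers both tails: \<open>l > 0\<close> gives the upper one,
  \<open>l < 0\<close> the lower one.\<close>

lemma emeasure_hits_tail_le:
  "emeasure (Pi\<^sub>M I M) {X \<in> space (Pi\<^sub>M I M). l * u \<le> l * hits X}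
    \<le> ennreal (exp ((exp l - 1) * mean_hits - l * u))"
proof -
  have "emeasure (Pi\<^sub>M I M) {X \<in> space (Pi\<^sub>M I M). l * u \<le> l * hits X}
      = (\<integral>\<^sup>+X. indicator {X \<in> space (Pi\<^sub>M I M). l * u \<le> l * hits X} X \<partial>Pi\<^sub>M I M)"
    by simp
  also have "\<dots> \<le> (\<integral>\<^sup>+X. ennreal (exp (- (l * u))) * ennreal (exp (l * hits X)) \<partial>Pi\<^sub>M I M)"
    by (intro nn_integral_mono)
       (auto simp: indicator_def ennreal_mult'[symmetric] exp_add[symmetric] simp flip: ennreal_1)
  also have "\<dots> = ennreal (exp (- (l * u))) * (\<integral>\<^sup>+X. ennreal (exp (l * hits X)) \<partial>Pi\<^sub>M I M)"
    by (rule nn_integral_cmult) measurable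
  also have "\<dots> \<le> ennreal (exp (- (l * u))) * ennreal (exp ((exp l - 1) * mean_hits))"
    by (intro mult_left_mono nn_integral_exp_hits_le) simp
  also have "\<dots> = ennreal (exp ((exp l - 1) * mean_hits - l * u))"
    by (simp add: ennreal_mult'[symmetric] exp_add[symmetric])
  finally show ?thesis .
qed

lemma emeasure_hits_ge_le:
  assumes m: "0 < mean_hits" and t: "0 \<le> t"
  shows "emeasure (Pi\<^sub>M I M) {X \<in> space (Pi\<^sub>M I M). mean_hits + t \<le> hits X}
    \<le> ennreal (exp (- (t\<^sup>2 / (2 * mean_hits + t))))"
proof -
  define m where "m = mean_hits"
  \<comment> \<open>the minimiser of \<open>(exp l - 1) * m - l * (m + t)\<close>\<close>
  define l where "l = ln (1 + t / m)"
  have m: "0 < m" using assms by (simp add: m_def)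
  have l0: "0 \<le> l" unfolding l_def using m t by simp
  have "2 * (t / m) / (2 + t / m) \<le> l"
    unfolding l_def by (rule ln_one_plus_lower_bound_rational) (use m t in simp)
  moreover have "2 * (t / m) / (2 + t / m) = 2 * t / (2 * m + t)"
    using m t by (simp add: field_simps)
  ultimately have "2 * t / (2 * m + t) * (m + t) \<le> l * (m + t)"
    using m t by (intro mult_right_mono) auto
  moreover have "2 * t / (2 * m + t) * (m + t) - t = t\<^sup>2 / (2 * m + t)"
    using m t by (simp add: field_simps power2_eq_square)
  moreover have "exp l = 1 + t / m" unfolding l_def using m t by (simp add: add_pos_nonneg)
  ultimately have expo: "(exp l - 1) * m - l * (m + t) \<le> - (t\<^sup>2 / (2 * m + t))"
    using m by simp
  have "emeasure (Pi\<^sub>M I M) {X \<in> space (Pi\<^sub>M I M). m + t \<le> hits X}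
      \<le> emeasure (Pi\<^sub>M I M) {X \<in> space (Pi\<^sub>M I M). l * (m + t) \<le> l * hits X}"
    using l0 by (intro emeasure_mono) (auto intro: mult_left_mono)
  also have "\<dots> \<le> ennreal (exp ((exp l - 1) * m - l * (m + t)))"
    unfolding m_def by (rule emeasure_hits_tail_le)
  also have "\<dots> \<le> ennreal (exp (- (t\<^sup>2 / (2 * m + t))))"
    using expo by (intro ennreal_leI) simp
  finally show ?thesis by (simp add: m_def)
qed

lemma emeasure_hits_le_le:
  assumes m: "0 < mean_hits" and s: "0 \<le> s"
  shows "emeasure (Pi\<^sub>M I M) {X \<in> space (Pi\<^sub>M I M). hits X \<le> mean_hits - s}
    \<le> ennreal (exp (- (s\<^sup>2 / (2 * mean_hits))))"
proof -
  define m where "m = mean_hits"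
  \<comment> \<open>the minimiser once \<open>exp (-l)\<close> is replaced by its quadratic upper bound\<close>
  define l where "l = s / m"
  have m: "0 < m" using assms by (simp add: m_def)
  have l0: "0 \<le> l" unfolding l_def using m s by simp
  have "(exp (-l) - 1) * m \<le> (- l + l\<^sup>2 / 2) * m"
    using m exp_minus_upper_bound_quadratic[OF l0] by (intro mult_right_mono) auto
  also have "\<dots> + l * (m - s) = - (s\<^sup>2 / (2 * m))"
    using m by (simp add: l_def field_simps power2_eq_square)
  finally have expo: "(exp (-l) - 1) * m - (-l) * (m - s) \<le> - (s\<^sup>2 / (2 * m))"
    by simp
  have "emeasure (Pi\<^sub>M I M) {X \<in> space (Pi\<^sub>M I M). hits X \<le> m - s}
      \<le> emeasure (Pi\<^sub>M I M) {X \<in> space (Pi\<^sub>M I M). (-l) * (m - s) \<le> (-l) * hits X}"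
    using l0 by (intro emeasure_mono) (auto intro: mult_left_mono)
  also have "\<dots> \<le> ennreal (exp ((exp (-l) - 1) * m - (-l) * (m - s)))"
    unfolding m_def by (rule emeasure_hits_tail_le)
  also have "\<dots> \<le> ennreal (exp (- (s\<^sup>2 / (2 * m))))"
    using expo by (intro ennreal_leI) simp
  finally show ?thesis by (simp add: m_def)
qed

end

section \<open>The interval test\<close>

definition arc_count :: "nat \<Rightarrow> real \<Rightarrow> (nat \<Rightarrow> real) \<Rightarrow> real \<Rightarrow> real" where
  "arc_count N w X a = (\<Sum>i=1..N. indicator (arc a (a + w)) (X i))"

lemma arc_count_bounds: "0 \<le> arc_count N w X a" "arc_count N w X a \<le> real N"
proof -
  show "0 \<le> arc_count N w X a"
    unfolding arc_count_def by (intro sum_nonneg) auto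
  have "arc_count N w X a \<le> (\<Sum>i=1..N. 1)"
    unfolding arc_count_def by (intro sum_mono) (auto simp: indicator_def)
  then show "arc_count N w X a \<le> real N" by simp
qed

lemma interval_test_arc_count:
  "interval_test N \<tau> \<gamma> X \<longleftrightarrow> (SUP a\<in>{0..<2*pi}. arc_count N (2*pi*\<tau>) X a) \<ge> \<gamma>"
  by (simp add: interval_test_def arc_count_def)

text \<open>Arcs only matter modulo a full turn, so the supremum over one period dominates the count at every
  real starting point, in particular at a data point or at \<open>\<Theta> - pi * \<tau>\<close>, wherever these
  lie.\<close>

lemma arc_count_le_SUP: "arc_count N w X a \<le> (SUP b\<in>{0..<2*pi}. arc_count N w X b)"
proof -
  define k where "k = \<lfloor>a / (2*pi)\<rfloor>"
  define b where "b = a - 2*pi * of_int k"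
  have "of_int k \<le> a / (2*pi)" "a / (2*pi) < of_int k + 1"
    unfolding k_def by linarith+
  then have b: "b \<in> {0..<2*pi}"
    unfolding b_def by (simp_all add: field_simps)
  have "arc_count N w X a = arc_count N w X b"
    using arc_shift_turns[of b k "b + w"] by (simp add: arc_count_def b_def algebra_simps)
  also have "\<dots> \<le> (SUP b\<in>{0..<2*pi}. arc_count N w X b)"
    by (intro cSUP_upper b bdd_aboveI2[where M="real N"] arc_count_bounds)
  finally show ?thesis .
qed

text \<open>Counts take finitely many values, so the supremum over a continuum of arcs is a maximum.\<close>

lemma SUP_arc_count_attained:
  "\<exists>a. (SUP b\<in>{0..<2*pi}. arc_count N w X b) = arc_count N w X a"
proof -
  have "arc_count N w X a = real (card {i\<in>{1..N}. X i \<in> arc a (a + w)})" for a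
    by (simp add: arc_count_def indicator_def sum.If_cases Int_def)
  moreover have "card {i\<in>{1..N}. X i \<in> arc a (a + w)} \<le> N" for a
  proof -
    have "card {i\<in>{1..N}. X i \<in> arc a (a + w)} \<le> card {1..N}"
      by (rule card_mono) auto
    then show ?thesis by simp
  qed
  ultimately have "arc_count N w X ` {0..<2*pi} \<subseteq> real ` {..N}" by auto
  then have fin: "finite (arc_count N w X ` {0..<2*pi})"
    by (rule finite_subset) auto
  have ne: "arc_count N w X ` {0..<2*pi} \<noteq> {}" by auto
  have "(SUP b\<in>{0..<2*pi}. arc_count N w X b) \<in> arc_count N w X ` {0..<2*pi}"
    unfolding cSup_eq_Max[OF fin ne] by (rule Max_in[OF fin ne])
  then show ?thesis by auto
qed

text \<open>An arc that is not empty can be slid forward until its left end meets the first data point it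
  contains; no point is lost on the way. Scanning the continuum of arcs therefore reduces to scanning
  the arcs that start at data points.\<close>

lemma arc_count_anchored:
  assumes "0 < arc_count N w X a"
  shows "\<exists>i\<in>{1..N}. arc_count N w X a \<le> arc_count N w X (X i)"
proof -
  define J where "J = {i\<in>{1..N}. X i \<in> arc a (a + w)}"
  have "J \<noteq> {}"
  proof
    assume "J = {}"
    then have "arc_count N w X a = 0"
      unfolding arc_count_def J_def by (intro sum.neutral) (auto simp: indicator_def)
    with assms show False by simp
  qed
  have "\<forall>i. \<exists>k::int. i \<in> J \<longrightarrow> a \<le> X i + 2*pi * of_int k \<and> X i + 2*pi * of_int k \<le> a + w"
    by (auto simp: J_def arc_iff)
  then obtain k :: "nat \<Rightarrow> int" where
    k: "\<And>i. i \<in> J \<Longrightarrow> a \<le> X i + 2*pi * of_int (k i) \<and> X i + 2*pi * of_int (k i) \<le> a + w"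
    by metis
  \<comment> \<open>the representatives of the captured angles inside \<open>{a..a + w}\<close>\<close>
  define f where "f i = X i + 2*pi * of_int (k i)" for i
  have "finite J" by (simp add: J_def)
  define i where "i = arg_min_on f J"
  have i: "i \<in> J"
    unfolding i_def by (rule arg_min_if_finite(1)) fact+
  have min: "f i \<le> f j" if "j \<in> J" for j
    unfolding i_def by (rule arg_min_least) fact+
  have "X j \<in> arc (X i) (X i + w)" if j: "j \<in> J" for j
  proof -
    have "X i \<le> X j + 2*pi * of_int (k j - k i)" "X j + 2*pi * of_int (k j - k i) \<le> X i + w"
      using min[OF j] k[OF i] k[OF j] by (simp_all add: f_def algebra_simps)
    then show ?thesis unfolding arc_iff by blast
  qed
  then have "arc_count N w X a \<le> arc_count N w X (X i)"
    unfolding arc_count_def by (intro sum_mono) (auto simp: J_def indicator_def)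
  moreover have "i \<in> {1..N}" using i by (simp add: J_def)
  ultimately show ?thesis by blast
qed

text \<open>This form has two uses: it makes the test measurable, as a finite union replaces the supremum, and
  it allows a union bound over \<open>N\<close> arcs. A threshold \<open>\<gamma> \<le> 0\<close> has to be excluded,
  because an empty arc could then reach it.\<close>

lemma interval_test_iff_anchored:
  assumes "0 < \<gamma>"
  shows "interval_test N \<tau> \<gamma> X \<longleftrightarrow> (\<exists>i\<in>{1..N}. \<gamma> \<le> arc_count N (2*pi*\<tau>) X (X i))"
proof
  assume "interval_test N \<tau> \<gamma> X"
  then obtain a where "\<gamma> \<le> arc_count N (2*pi*\<tau>) X a"
    using SUP_arc_count_attained[of N "2*pi*\<tau>" X] by (auto simp: interval_test_arc_count)
  with arc_count_anchored[of N "2*pi*\<tau>" X a] assms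
  show "\<exists>i\<in>{1..N}. \<gamma> \<le> arc_count N (2*pi*\<tau>) X (X i)"
    by force
qed (use arc_count_le_SUP in \<open>force simp: interval_test_arc_count intro: order_trans\<close>)

lemma measurable_arc_count_anchored [measurable]:
  assumes "i \<in> {1..N}"
  shows "(\<lambda>X. arc_count N w X (X i)) \<in> borel_measurable (Pi\<^sub>M {1..N} (\<lambda>_. borel))"
proof -
  have [measurable]: "(\<lambda>X. X j) \<in> borel_measurable (Pi\<^sub>M {1..N} (\<lambda>_. borel :: real measure))"
    if "j \<in> {1..N}" for j
    using that by (rule measurable_component_singleton)
  have "(\<lambda>X. indicator (arc (X i) (X i + w)) (X j) :: real)
      \<in> borel_measurable (Pi\<^sub>M {1..N} (\<lambda>_. borel))" if j: "j \<in> {1..N}" for j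
  proof -
    note [measurable] = j assms
    have "(\<lambda>X. if X j \<in> arc (X i) (X i + w) then 1 else 0 :: real)
      \<in> borel_measurable (Pi\<^sub>M {1..N} (\<lambda>_. borel))" by measurable
    then show ?thesis by (simp add: indicator_def of_bool_def)
  qed
  then show ?thesis unfolding arc_count_def by (rule borel_measurable_sum)
qed

lemma is_test_interval_test: "is_test N (interval_test N \<tau> \<gamma>)"
proof (cases "0 < \<gamma>")
  case True
  have "Measurable.pred (Pi\<^sub>M {1..N} (\<lambda>_. borel))
      (\<lambda>X. \<exists>i\<in>{1..N}. \<gamma> \<le> arc_count N (2*pi*\<tau>) X (X i))"
    by measurable
  then show ?thesis
    unfolding is_test_def by (subst interval_test_iff_anchored[OF True, abs_def])
next
  case False
  then have "\<gamma> \<le> (SUP b\<in>{0..<2*pi}. arc_count N (2*pi*\<tau>) X b)" for X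
    using arc_count_le_SUP[of N "2*pi*\<tau>" X 0] arc_count_bounds(1)[of N "2*pi*\<tau>" X 0]
    by linarith
  then have "interval_test N \<tau> \<gamma> = (\<lambda>X. True)"
    by (simp add: interval_test_arc_count fun_eq_iff)
  then show ?thesis by (simp add: is_test_def)
qed

section \<open>The planted law as a mixture of densities\<close>

lemma sets_null_law [measurable_cong, simp]: "sets (null_law N) = sets (Pi\<^sub>M {1..N} (\<lambda>_. borel))"
  unfolding null_law_def by (intro sets_PiM_cong) auto

lemma space_null_law: "space (null_law N) = space (Pi\<^sub>M {1..N} (\<lambda>_. borel))"
  by (rule sets_eq_imp_space_eq) simp

lemma prob_space_null_law: "prob_space (null_law N)"
  unfolding null_law_def by (intro prob_space_PiM prob_space_uniform_angle)

lemma sets_conditional_law [simp]: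
  "sets (conditional_law N \<kappa> S \<Theta>) = sets (Pi\<^sub>M {1..N} (\<lambda>_. borel))"
  unfolding conditional_law_def by (intro sets_PiM_cong) auto

lemma prob_space_conditional_law: "prob_space (conditional_law N \<kappa> S \<Theta>)"
  unfolding conditional_law_def
  by (intro prob_space_PiM) (simp add: prob_space_uniform_angle prob_space_von_mises)

text \<open>The likelihood ratio of the conditional law against the null law. The product runs over all
  coordinates, so that its index set does not vary with \<open>S\<close>: joint measurability in
  \<open>(S, \<Theta>, X)\<close> is then that of a fixed finite product.\<close>

definition planted_lr :: "nat \<Rightarrow> real \<Rightarrow> nat set \<Rightarrow> real \<Rightarrow> (nat \<Rightarrow> real) \<Rightarrow> real" where
  "planted_lr N \<kappa> S \<Theta> X = (\<Prod>i\<in>{1..N}. if i \<in> S then von_mises_lr \<kappa> \<Theta> (X i) else 1)"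

lemma planted_lr_nonneg [simp]: "0 \<le> planted_lr N \<kappa> S \<Theta> X"
  unfolding planted_lr_def by (intro prod_nonneg) auto

lemma measurable_planted_lr [measurable]:
  assumes [measurable]: "f \<in> M \<rightarrow>\<^sub>M count_space UNIV" "g \<in> borel_measurable M"
    "h \<in> M \<rightarrow>\<^sub>M Pi\<^sub>M {1..N} (\<lambda>_. borel)"
  shows "(\<lambda>z. planted_lr N \<kappa> (f z) (g z) (h z)) \<in> borel_measurable M"
proof -
  have "(\<lambda>z. if i \<in> f z then von_mises_lr \<kappa> (g z) (h z i) else 1) \<in> borel_measurable M"
    if i: "i \<in> {1..N}" for i
  proof -
    have [measurable]: "(\<lambda>z. h z i) \<in> borel_measurable M"
      using measurable_compose[OF assms(3) measurable_component_singleton[OF i]] by simp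
    have "Measurable.pred (count_space UNIV) (\<lambda>S. i \<in> S)" by simp
    from measurable_compose[OF assms(1) this]
    have [measurable]: "Measurable.pred M (\<lambda>z. i \<in> f z)" .
    show ?thesis by measurable
  qed
  then show ?thesis unfolding planted_lr_def by (rule borel_measurable_prod)
qed

lemma product_sigma_finite_uniform_angle: "product_sigma_finite (\<lambda>_::nat. uniform_angle)"
  by (simp add: product_sigma_finite_def U.sigma_finite_measure_axioms)

text \<open>A product measure is determined by its values on boxes, and on a box the integral of the product
  density splits into one factor per coordinate.\<close>

lemma conditional_law_density:
  "conditional_law N \<kappa> S \<Theta> = density (null_law N) (\<lambda>X. ennreal (planted_lr N \<kappa> S \<Theta> X))"
proof -
  define M where "M i = (if i \<in> S then von_mises \<Theta> \<kappa> else uniform_angle)" for i :: nat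
  define f where "f i x = (if i \<in> S then von_mises_lr \<kappa> \<Theta> x else 1)" for i :: nat and x
  have f_meas [measurable]: "f i \<in> borel_measurable borel" for i
    unfolding f_def by simp
  have M_density: "M i = density uniform_angle (\<lambda>x. ennreal (f i x))" for i
    by (simp add: M_def f_def von_mises_density density_1)
  have sets_M: "sets (M i) = sets borel" for i by (simp add: M_def)
  have prob_M: "prob_space (M i)" for i
    by (simp add: M_def prob_space_uniform_angle prob_space_von_mises)
  interpret P: product_sigma_finite M
    unfolding product_sigma_finite_def using prob_M prob_space_imp_sigma_finite by blast
  interpret Q: product_sigma_finite "\<lambda>_::nat. uniform_angle"
    by (rule product_sigma_finite_uniform_angle)
  have "density (null_law N) (\<lambda>X. ennreal (planted_lr N \<kappa> S \<Theta> X)) = Pi\<^sub>M {1..N} M"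
  proof (rule P.PiM_eqI)
    show "sets (density (null_law N) (\<lambda>X. ennreal (planted_lr N \<kappa> S \<Theta> X))) = sets (Pi\<^sub>M {1..N} M)"
      using sets_M by (auto intro!: sets_PiM_cong)
    fix A assume A: "\<And>i. i \<in> {1..N} \<Longrightarrow> A i \<in> sets (M i)"
    then have A' [measurable]: "A i \<in> sets borel" if "i \<in> {1..N}" for i
      using that sets_M by blast
    have A_PiE: "Pi\<^sub>E {1..N} A \<in> sets (Pi\<^sub>M {1..N} (\<lambda>_. borel))"
      by (rule sets_PiM_I_finite) (use A' in auto)
    have "emeasure (density (null_law N) (\<lambda>X. ennreal (planted_lr N \<kappa> S \<Theta> X))) (Pi\<^sub>E {1..N} A)
        = (\<integral>\<^sup>+X. ennreal (planted_lr N \<kappa> S \<Theta> X) * indicator (Pi\<^sub>E {1..N} A) X \<partial>null_law N)"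
      using A_PiE by (intro emeasure_density) (auto intro!: measurable_compose[OF _ measurable_ennreal])
    also have "\<dots> = (\<integral>\<^sup>+X. (\<Prod>i\<in>{1..N}. ennreal (f i (X i)) * indicator (A i) (X i)) \<partial>null_law N)"
    proof (intro nn_integral_cong)
      fix X assume "X \<in> space (null_law N)"
      then have "X \<in> extensional {1..N}" by (auto simp: space_null_law space_PiM PiE_def)
      then have "indicator (Pi\<^sub>E {1..N} A) X = (\<Prod>i\<in>{1..N}. indicator (A i) (X i) :: ennreal)"
        by (auto simp: indicator_def PiE_iff prod.neutral intro!: prod_zero[symmetric] prod.neutral[symmetric])
      moreover have "ennreal (planted_lr N \<kappa> S \<Theta> X) = (\<Prod>i\<in>{1..N}. ennreal (f i (X i)))"
        unfolding planted_lr_def f_def by (subst prod_ennreal) auto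
      ultimately show "ennreal (planted_lr N \<kappa> S \<Theta> X) * indicator (Pi\<^sub>E {1..N} A) X
          = (\<Prod>i\<in>{1..N}. ennreal (f i (X i)) * indicator (A i) (X i))"
        by (simp add: prod.distrib)
    qed
    also have "\<dots> = (\<Prod>i\<in>{1..N}. \<integral>\<^sup>+x. ennreal (f i x) * indicator (A i) x \<partial>uniform_angle)"
      unfolding null_law_def by (rule Q.product_nn_integral_prod) (use A' in auto)
    also have "\<dots> = (\<Prod>i\<in>{1..N}. emeasure (M i) (A i))"
      using A' by (intro prod.cong) (auto simp: M_density emeasure_density)
    finally show "emeasure (density (null_law N) (\<lambda>X. ennreal (planted_lr N \<kappa> S \<Theta> X))) (Pi\<^sub>E {1..N} A)
        = (\<Prod>i\<in>{1..N}. emeasure (M i) (A i))" .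
  qed simp
  then show ?thesis by (simp add: conditional_law_def M_def[abs_def])
qed

lemma sets_latent_prior [measurable_cong]:
  "sets (latent_prior N K) = sets (count_space UNIV \<Otimes>\<^sub>M borel)"
  unfolding latent_prior_def by (intro sets_pair_measure_cong) auto

lemma prob_space_latent_prior: "prob_space (latent_prior N K)"
proof -
  interpret pair_prob_space "measure_pmf (pmf_of_set {S. S \<subseteq> {1..N} \<and> card S = K})" uniform_angle
    by unfold_locales
  show ?thesis unfolding latent_prior_def by unfold_locales
qed

lemma nn_integral_latent_prior:
  assumes "g \<in> borel_measurable (latent_prior N K)"
  shows "(\<integral>\<^sup>+z. g z \<partial>latent_prior N K)
    = (\<integral>\<^sup>+S. (\<integral>\<^sup>+\<Theta>. g (S, \<Theta>) \<partial>uniform_angle) \<partial>measure_pmf (pmf_of_set {S. S \<subseteq> {1..N} \<and> card S = K}))"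
  using assms unfolding latent_prior_def by (rule U.nn_integral_fst[symmetric])

text \<open>The monadic bind that defines the planted law has its intended meaning only for a measurable kernel.
  The density representation reduces measurability to that of a parameter integral.\<close>

lemma measurable_conditional_law:
  "(\<lambda>(S, \<Theta>). conditional_law N \<kappa> S \<Theta>)
    \<in> latent_prior N K \<rightarrow>\<^sub>M subprob_algebra (Pi\<^sub>M {1..N} (\<lambda>_. borel))"
proof (rule measurable_subprob_algebra)
  fix z assume "z \<in> space (latent_prior N K)"
  show "subprob_space (case z of (S, \<Theta>) \<Rightarrow> conditional_law N \<kappa> S \<Theta>)"
    by (auto split: prod.split intro: prob_space_imp_subprob_space prob_space_conditional_law)
  show "sets (case z of (S, \<Theta>) \<Rightarrow> conditional_law N \<kappa> S \<Theta>) = sets (Pi\<^sub>M {1..N} (\<lambda>_. borel))"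
    by (auto split: prod.split)
next
  interpret Q: prob_space "null_law N" by (rule prob_space_null_law)
  fix A assume A [measurable]: "A \<in> sets (Pi\<^sub>M {1..N} (\<lambda>_. borel :: real measure))"
  have "(\<lambda>z. \<integral>\<^sup>+X. ennreal (planted_lr N \<kappa> (fst z) (snd z) X) * indicator A X \<partial>null_law N)
      \<in> borel_measurable (count_space UNIV \<Otimes>\<^sub>M borel)"
    by measurable
  moreover have "emeasure (conditional_law N \<kappa> S \<Theta>) A
      = (\<integral>\<^sup>+X. ennreal (planted_lr N \<kappa> S \<Theta> X) * indicator A X \<partial>null_law N)" for S \<Theta>
    unfolding conditional_law_density by (rule emeasure_density) measurable
  ultimately show "(\<lambda>z. emeasure (case z of (S, \<Theta>) \<Rightarrow> conditional_law N \<kappa> S \<Theta>) A)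
      \<in> borel_measurable (latent_prior N K)"
    by (simp add: case_prod_beta cong: measurable_cong_sets[OF sets_latent_prior refl])
qed

lemma space_latent_prior_nonempty: "space (latent_prior N K) \<noteq> {}"
  using prob_space.not_empty[OF prob_space_latent_prior] .

lemma sets_planted_law [simp]: "sets (planted_law N K \<kappa>) = sets (Pi\<^sub>M {1..N} (\<lambda>_. borel))"
  unfolding planted_law_def
  by (rule sets_bind[OF _ space_latent_prior_nonempty]) (auto split: prod.split)

lemma space_planted_law: "space (planted_law N K \<kappa>) = space (null_law N)"
  by (rule sets_eq_imp_space_eq) simp

lemma emeasure_planted_law:
  assumes "A \<in> sets (Pi\<^sub>M {1..N} (\<lambda>_. borel))"
  shows "emeasure (planted_law N K \<kappa>) A
    = (\<integral>\<^sup>+(S, \<Theta>). emeasure (conditional_law N \<kappa> S \<Theta>) A \<partial>latent_prior N K)"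
  unfolding planted_law_def
  by (subst emeasure_bind[OF space_latent_prior_nonempty measurable_conditional_law assms])
     (auto intro!: nn_integral_cong split: prod.split)

lemma prob_space_planted_law: "prob_space (planted_law N K \<kappa>)"
  unfolding planted_law_def
proof (rule prob_space.prob_space_bind[OF prob_space_latent_prior _ measurable_conditional_law])
  show "AE x in latent_prior N K. prob_space (case x of (S, \<Theta>) \<Rightarrow> conditional_law N \<kappa> S \<Theta>)"
    by (auto split: prod.split simp: prob_space_conditional_law)
qed

text \<open>The extended nonnegative codomain lets Tonelli's theorem apply with no integrability conditions;
  finiteness almost everywhere is recovered later from the total mass.\<close>

definition mixture_lr :: "nat \<Rightarrow> nat \<Rightarrow> real \<Rightarrow> (nat \<Rightarrow> real) \<Rightarrow> ennreal" where
  "mixture_lr N K \<kappa> X = (\<integral>\<^sup>+(S, \<Theta>). ennreal (planted_lr N \<kappa> S \<Theta> X) \<partial>latent_prior N K)"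

lemma measurable_mixture_lr [measurable]: "mixture_lr N K \<kappa> \<in> borel_measurable (null_law N)"
proof -
  interpret L: prob_space "latent_prior N K" by (rule prob_space_latent_prior)
  have "(\<lambda>X. \<integral>\<^sup>+z. ennreal (planted_lr N \<kappa> (fst z) (snd z) X) \<partial>latent_prior N K)
      \<in> borel_measurable (null_law N)"
    by measurable
  then show ?thesis by (simp add: mixture_lr_def[abs_def] case_prod_beta)
qed

lemma planted_law_density: "planted_law N K \<kappa> = density (null_law N) (mixture_lr N K \<kappa>)"
proof (rule measure_eqI)
  interpret L: prob_space "latent_prior N K" by (rule prob_space_latent_prior)
  interpret Q: prob_space "null_law N" by (rule prob_space_null_law)
  interpret QL: pair_sigma_finite "null_law N" "latent_prior N K" ..
  fix A assume "A \<in> sets (planted_law N K \<kappa>)"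
  then have A [measurable]: "A \<in> sets (Pi\<^sub>M {1..N} (\<lambda>_. borel))" by simp
  have "emeasure (planted_law N K \<kappa>) A
      = (\<integral>\<^sup>+z. \<integral>\<^sup>+X. ennreal (planted_lr N \<kappa> (fst z) (snd z) X) * indicator A X \<partial>null_law N \<partial>latent_prior N K)"
    unfolding emeasure_planted_law[OF A] conditional_law_density
  proof (intro nn_integral_cong, clarify)
    fix S \<Theta>
    show "emeasure (density (null_law N) (\<lambda>X. ennreal (planted_lr N \<kappa> S \<Theta> X))) A
        = (\<integral>\<^sup>+X. ennreal (planted_lr N \<kappa> (fst (S, \<Theta>)) (snd (S, \<Theta>)) X) * indicator A X \<partial>null_law N)"
      unfolding fst_conv snd_conv by (rule emeasure_density) measurable
  qed
  also have "\<dots> = (\<integral>\<^sup>+X. \<integral>\<^sup>+z. ennreal (planted_lr N \<kappa> (fst z) (snd z) X) * indicator A X \<partial>latent_prior N K \<partial>null_law N)"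
    by (rule QL.Fubini') measurable
  also have "\<dots> = (\<integral>\<^sup>+X. mixture_lr N K \<kappa> X * indicator A X \<partial>null_law N)"
  proof (rule nn_integral_cong)
    fix X assume X [measurable]: "X \<in> space (null_law N)"
    have "(\<lambda>z. ennreal (planted_lr N \<kappa> (fst z) (snd z) X)) \<in> borel_measurable (latent_prior N K)"
      using X unfolding space_null_law by measurable
    from nn_integral_multc[OF this]
    show "(\<integral>\<^sup>+z. ennreal (planted_lr N \<kappa> (fst z) (snd z) X) * indicator A X \<partial>latent_prior N K)
        = mixture_lr N K \<kappa> X * indicator A X"
      by (simp add: mixture_lr_def case_prod_beta')
  qed
  also have "\<dots> = emeasure (density (null_law N) (mixture_lr N K \<kappa>)) A"
    using A by (intro emeasure_density[symmetric]) simp_all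
  finally show "emeasure (planted_law N K \<kappa>) A = emeasure (density (null_law N) (mixture_lr N K \<kappa>)) A" .
qed simp

section \<open>Error probabilities of the interval test\<close>

lemma sets_anchored_count:
  assumes "i \<in> {1..N}"
  shows "{X \<in> space (null_law N). u \<le> arc_count N w X (X i)} \<in> sets (null_law N)"
  unfolding space_null_law sets_null_law
  by (intro borel_measurable_le borel_measurable_const measurable_arc_count_anchored assms)

text \<open>Freeze the anchor \<open>X i = y\<close>. The anchor itself accounts for at most one hit, and the other
  \<open>N - 1\<close> angles fall into the now deterministic arc independently with probability
  \<open>\<tau>\<close>, so the upper Chernoff bound applies; Fubini then removes the conditioning. The
  summand \<open>1\<close> in the threshold pays for the anchor.\<close>

lemma emeasure_anchored_count_le:
  assumes N: "2 \<le> N" and i: "i \<in> {1..N}" and \<tau>: "0 < \<tau>" "\<tau> < 1" and t: "0 \<le> t"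
  defines "\<mu> \<equiv> (real N - 1) * \<tau>"
  shows "emeasure (null_law N) {X \<in> space (null_law N). 1 + \<mu> + t \<le> arc_count N (2*pi*\<tau>) X (X i)}
    \<le> ennreal (exp (- (t\<^sup>2 / (2 * \<mu> + t))))"
proof -
  define J where "J = {1..N} - {i}"
  have insert: "{1..N} = insert i J" and "i \<notin> J" and [simp]: "finite J" and card_J: "real (card J) = real N - 1"
    using i by (auto simp: J_def of_nat_diff)
  define E where "E = {X \<in> space (null_law N). 1 + \<mu> + t \<le> arc_count N (2*pi*\<tau>) X (X i)}"
  have E_sets: "E \<in> sets (null_law N)"
    unfolding E_def by (rule sets_anchored_count[OF i])
  interpret Q: product_sigma_finite "\<lambda>_::nat. uniform_angle"
    by (rule product_sigma_finite_uniform_angle)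
  interpret QJ: prob_space "Pi\<^sub>M J (\<lambda>_. uniform_angle)"
    by (intro prob_space_PiM prob_space_uniform_angle)
  have \<mu>_pos: "0 < \<mu>" using N \<tau> by (simp add: \<mu>_def)
  have inner: "(\<integral>\<^sup>+X. indicator E (X(i := y)) \<partial>Pi\<^sub>M J (\<lambda>_. uniform_angle))
      \<le> ennreal (exp (- (t\<^sup>2 / (2 * \<mu> + t))))" for y
  proof -
    interpret H: independent_hits J "\<lambda>_. uniform_angle" "\<lambda>_. arc y (y + 2*pi*\<tau>)"
      by (rule independent_hits.intro) (simp_all add: prob_space_uniform_angle)
    have mean: "H.mean_hits = \<mu>"
      using \<tau> emeasure_uniform_angle_arc[OF \<tau>, of y]
      by (simp add: H.mean_hits_def measure_def card_J \<mu>_def)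
    have "indicator E (X(i := y)) \<le> (indicator {X \<in> space (Pi\<^sub>M J (\<lambda>_. uniform_angle)). \<mu> + t \<le> H.hits X} X :: ennreal)"
      if X: "X \<in> space (Pi\<^sub>M J (\<lambda>_. uniform_angle))" for X
    proof -
      have "arc_count N (2*pi*\<tau>) (X(i := y)) y \<le> 1 + H.hits X"
      proof -
        have "arc_count N (2*pi*\<tau>) (X(i := y)) y
            = indicator (arc y (y + 2*pi*\<tau>)) y + (\<Sum>j\<in>J. indicator (arc y (y + 2*pi*\<tau>)) ((X(i := y)) j))"
          unfolding arc_count_def insert using \<open>i \<notin> J\<close> by (subst sum.insert) simp_all
        also have "(\<Sum>j\<in>J. indicator (arc y (y + 2*pi*\<tau>)) ((X(i := y)) j)) = H.hits X"
          unfolding H.hits_def using \<open>i \<notin> J\<close> by (intro sum.cong) auto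
        also have "indicator (arc y (y + 2*pi*\<tau>)) y + H.hits X \<le> 1 + H.hits X"
          by (simp add: indicator_def)
        finally show ?thesis .
      qed
      then show ?thesis using X by (auto simp: E_def indicator_def)
    qed
    then have "(\<integral>\<^sup>+X. indicator E (X(i := y)) \<partial>Pi\<^sub>M J (\<lambda>_. uniform_angle))
        \<le> (\<integral>\<^sup>+X. indicator {X \<in> space (Pi\<^sub>M J (\<lambda>_. uniform_angle)). \<mu> + t \<le> H.hits X} X \<partial>Pi\<^sub>M J (\<lambda>_. uniform_angle))"
      by (intro nn_integral_mono)
    also have "\<dots> = emeasure (Pi\<^sub>M J (\<lambda>_. uniform_angle)) {X \<in> space (Pi\<^sub>M J (\<lambda>_. uniform_angle)). \<mu> + t \<le> H.hits X}"
      by (rule nn_integral_indicator) measurable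
    also have "\<dots> \<le> ennreal (exp (- (t\<^sup>2 / (2 * \<mu> + t))))"
      using H.emeasure_hits_ge_le[of t] \<mu>_pos t by (simp add: mean)
    finally show ?thesis .
  qed
  have "emeasure (null_law N) E = (\<integral>\<^sup>+X. indicator E X \<partial>Pi\<^sub>M (insert i J) (\<lambda>_. uniform_angle))"
    using nn_integral_indicator[OF E_sets] unfolding null_law_def insert by simp
  also have "\<dots> = (\<integral>\<^sup>+y. (\<integral>\<^sup>+X. indicator E (X(i := y)) \<partial>Pi\<^sub>M J (\<lambda>_. uniform_angle)) \<partial>uniform_angle)"
    using E_sets \<open>i \<notin> J\<close> unfolding null_law_def insert
    by (intro Q.product_nn_integral_insert_rev) simp_all
  also have "\<dots> \<le> (\<integral>\<^sup>+y. ennreal (exp (- (t\<^sup>2 / (2 * \<mu> + t)))) \<partial>uniform_angle)"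
    by (intro nn_integral_mono inner)
  also have "\<dots> = ennreal (exp (- (t\<^sup>2 / (2 * \<mu> + t))))"
    using U.emeasure_space_1 by simp
  finally show ?thesis by (simp add: E_def)
qed

lemma sets_interval_test_accepts:
  "{X \<in> space (Pi\<^sub>M {1..N} (\<lambda>_. borel)). \<not> interval_test N \<tau> \<gamma> X} \<in> sets (Pi\<^sub>M {1..N} (\<lambda>_. borel))"
proof -
  have [measurable]: "Measurable.pred (Pi\<^sub>M {1..N} (\<lambda>_. borel)) (interval_test N \<tau> \<gamma>)"
    using is_test_interval_test by (simp add: is_test_def)
  show ?thesis by measurable
qed

lemma p_fa_interval_test_le:
  assumes N: "2 \<le> N" and \<tau>: "0 < \<tau>" "\<tau> < 1" and \<gamma>: "1 + (real N - 1) * \<tau> \<le> \<gamma>"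
  defines "\<mu> \<equiv> (real N - 1) * \<tau>" and "t \<equiv> \<gamma> - 1 - (real N - 1) * \<tau>"
  shows "p_fa N (interval_test N \<tau> \<gamma>) \<le> real N * exp (- (t\<^sup>2 / (2 * \<mu> + t)))"
proof -
  interpret Q: prob_space "null_law N" by (rule prob_space_null_law)
  define E where "E i = {X \<in> space (null_law N). 1 + \<mu> + t \<le> arc_count N (2*pi*\<tau>) X (X i)}" for i
  have t: "0 \<le> t" using \<gamma> by (simp add: t_def)
  have "0 \<le> (real N - 1) * \<tau>" using N \<tau> by simp
  then have \<gamma>_pos: "0 < \<gamma>" using \<gamma> by linarith
  have \<gamma>_eq: "1 + \<mu> + t = \<gamma>" by (simp add: \<mu>_def t_def)
  have E_sets: "E i \<in> sets (null_law N)" if "i \<in> {1..N}" for i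
    unfolding E_def by (rule sets_anchored_count[OF that])
  have "emeasure (null_law N) {X \<in> space (null_law N). interval_test N \<tau> \<gamma> X}
      = emeasure (null_law N) (\<Union>i\<in>{1..N}. E i)"
    by (intro arg_cong[where f="emeasure _"])
       (auto simp: interval_test_iff_anchored[OF \<gamma>_pos] E_def \<gamma>_eq)
  also have "\<dots> \<le> (\<Sum>i\<in>{1..N}. emeasure (null_law N) (E i))"
    using E_sets by (intro emeasure_subadditive_finite) auto
  also have "\<dots> \<le> (\<Sum>i\<in>{1..N}. ennreal (exp (- (t\<^sup>2 / (2 * \<mu> + t)))))"
    unfolding E_def \<mu>_def by (intro sum_mono emeasure_anchored_count_le N \<tau> t)
  also have "\<dots> = ennreal (real N * exp (- (t\<^sup>2 / (2 * \<mu> + t))))"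
    by (simp add: ennreal_mult ennreal_of_nat_eq_real_of_nat)
  finally show ?thesis
    by (simp add: p_fa_def Q.emeasure_eq_measure)
qed

text \<open>The supremum is at least the count in the arc centred at the true phase. That count has mean
  \<open>m\<close>: the \<open>N - K\<close> uniform angles hit with probability \<open>\<tau>\<close>, the
  \<open>K\<close> planted ones with probability \<open>arc_prob \<kappa> \<tau>\<close>.\<close>

lemma emeasure_conditional_law_miss_le:
  assumes \<tau>: "0 < \<tau>" "\<tau> < 1" and S: "S \<subseteq> {1..N}" "card S = K" and s: "0 \<le> s"
    and m: "m = real N * \<tau> + real K * (arc_prob \<kappa> \<tau> - \<tau>)" "0 < m"
  shows "emeasure (conditional_law N \<kappa> S \<Theta>)
      {X \<in> space (Pi\<^sub>M {1..N} (\<lambda>_. borel)). \<not> interval_test N \<tau> (m - s) X}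
    \<le> ennreal (exp (- (s\<^sup>2 / (2 * m))))"
proof -
  define a where "a = \<Theta> - pi*\<tau>"
  define M where "M i = (if i \<in> S then von_mises \<Theta> \<kappa> else uniform_angle)" for i :: nat
  have a_arc: "arc a (a + 2*pi*\<tau>) = arc (\<Theta> - pi*\<tau>) (\<Theta> + pi*\<tau>)"
    by (simp add: a_def algebra_simps)
  interpret H: independent_hits "{1..N}" M "\<lambda>_. arc a (a + 2*pi*\<tau>)"
    by (rule independent_hits.intro)
       (simp_all add: M_def prob_space_uniform_angle prob_space_von_mises)
  have "measure (M i) (arc a (a + 2*pi*\<tau>)) = (if i \<in> S then arc_prob \<kappa> \<tau> else \<tau>)" for i
    using \<tau> emeasure_uniform_angle_arc[OF \<tau>, of a] emeasure_von_mises_arc[of \<Theta> \<kappa> \<tau>]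
    by (simp add: M_def measure_def a_arc arc_prob_def)
  then have "H.mean_hits = (\<Sum>i\<in>{1..N}. \<tau> + (if i \<in> S then arc_prob \<kappa> \<tau> - \<tau> else 0))"
    unfolding H.mean_hits_def by (intro sum.cong) auto
  also have "\<dots> = m"
    using S by (simp add: sum.distrib sum.If_cases Int_absorb1 m)
  finally have mean: "H.mean_hits = m" .
  have hits: "H.hits X = arc_count N (2*pi*\<tau>) X a" for X
    unfolding H.hits_def arc_count_def ..
  have sets_M: "sets (Pi\<^sub>M {1..N} M) = sets (Pi\<^sub>M {1..N} (\<lambda>_. borel))"
    by (intro sets_PiM_cong) (auto simp: M_def)
  have law: "conditional_law N \<kappa> S \<Theta> = Pi\<^sub>M {1..N} M"
    by (simp add: conditional_law_def M_def[abs_def])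
  have "emeasure (Pi\<^sub>M {1..N} M) {X \<in> space (Pi\<^sub>M {1..N} (\<lambda>_. borel)). \<not> interval_test N \<tau> (m - s) X}
      \<le> emeasure (Pi\<^sub>M {1..N} M) {X \<in> space (Pi\<^sub>M {1..N} M). H.hits X \<le> m - s}"
  proof (intro emeasure_mono subsetI)
    fix X assume "X \<in> {X \<in> space (Pi\<^sub>M {1..N} (\<lambda>_. borel)). \<not> interval_test N \<tau> (m - s) X}"
    then show "X \<in> {X \<in> space (Pi\<^sub>M {1..N} M). H.hits X \<le> m - s}"
      using arc_count_le_SUP[of N "2*pi*\<tau>" X a] sets_eq_imp_space_eq[OF sets_M]
      by (auto simp: interval_test_arc_count hits simp del: One_nat_def)
  qed measurable
  also have "\<dots> \<le> ennreal (exp (- (s\<^sup>2 / (2 * m))))"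
    using H.emeasure_hits_le_le[of s] s m(2) unfolding mean by blast
  finally show ?thesis by (simp add: law)
qed

lemma finite_subsets_of_card: "finite {S. S \<subseteq> {1..N::nat} \<and> card S = K}"
  by (rule finite_subset[of _ "Pow {1..N}"]) auto

lemma subsets_of_card_nonempty: "K \<le> N \<Longrightarrow> {S. S \<subseteq> {1..N::nat} \<and> card S = K} \<noteq> {}"
  using obtain_subset_with_card_n[of K "{1..N}"] by auto

text \<open>The conditional bound depends neither on the subset nor on the phase, so it survives averaging over
  the prior. It holds for subsets of size \<open>K\<close> only, which the prior picks almost surely.\<close>

lemma p_miss_interval_test_le:
  assumes K: "K \<le> N" and \<tau>: "0 < \<tau>" "\<tau> < 1" and s: "0 \<le> s"
    and m: "m = real N * \<tau> + real K * (arc_prob \<kappa> \<tau> - \<tau>)" "0 < m"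
  shows "p_miss N K \<kappa> (interval_test N \<tau> (m - s)) \<le> exp (- (s\<^sup>2 / (2 * m)))"
proof -
  interpret P: prob_space "planted_law N K \<kappa>" by (rule prob_space_planted_law)
  interpret L: prob_space "latent_prior N K" by (rule prob_space_latent_prior)
  define E where "E = {X \<in> space (Pi\<^sub>M {1..N} (\<lambda>_. borel)). \<not> interval_test N \<tau> (m - s) X}"
  define prior where "prior = pmf_of_set {S. S \<subseteq> {1..N} \<and> card S = K}"
  have set_prior: "set_pmf prior = {S. S \<subseteq> {1..N} \<and> card S = K}"
    unfolding prior_def using finite_subsets_of_card subsets_of_card_nonempty[OF K] by (rule set_pmf_of_set[rotated])
  have E_sets: "E \<in> sets (Pi\<^sub>M {1..N} (\<lambda>_. borel))"
    unfolding E_def by (rule sets_interval_test_accepts)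
  have "(\<lambda>z. emeasure ((\<lambda>(S, \<Theta>). conditional_law N \<kappa> S \<Theta>) z) E) \<in> borel_measurable (latent_prior N K)"
    by (rule measurable_emeasure_subprob_algebra[THEN measurable_compose[OF measurable_conditional_law], OF E_sets])
  then have meas: "(\<lambda>(S, \<Theta>). emeasure (conditional_law N \<kappa> S \<Theta>) E) \<in> borel_measurable (latent_prior N K)"
    by (simp add: case_prod_beta')
  have "emeasure (planted_law N K \<kappa>) E
      = (\<integral>\<^sup>+S. (\<integral>\<^sup>+\<Theta>. emeasure (conditional_law N \<kappa> S \<Theta>) E \<partial>uniform_angle) \<partial>measure_pmf prior)"
    unfolding emeasure_planted_law[OF E_sets] prior_def
    using nn_integral_latent_prior[OF meas] by simp
  also have "\<dots> \<le> (\<integral>\<^sup>+S. (\<integral>\<^sup>+\<Theta>. ennreal (exp (- (s\<^sup>2 / (2 * m)))) \<partial>uniform_angle) \<partial>measure_pmf prior)"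
  proof (intro nn_integral_mono_AE)
    show "AE S in measure_pmf prior. (\<integral>\<^sup>+\<Theta>. emeasure (conditional_law N \<kappa> S \<Theta>) E \<partial>uniform_angle)
        \<le> (\<integral>\<^sup>+\<Theta>. ennreal (exp (- (s\<^sup>2 / (2 * m)))) \<partial>uniform_angle)"
      unfolding E_def
      by (intro AE_pmfI nn_integral_mono emeasure_conditional_law_miss_le[OF \<tau> _ _ s m])
         (auto simp: set_prior)
  qed
  also have "\<dots> = ennreal (exp (- (s\<^sup>2 / (2 * m))))"
    using U.emeasure_space_1 by simp
  finally have "emeasure (planted_law N K \<kappa>) E \<le> ennreal (exp (- (s\<^sup>2 / (2 * m))))" .
  moreover have "space (planted_law N K \<kappa>) = space (Pi\<^sub>M {1..N} (\<lambda>_. borel))"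
    by (simp add: space_planted_law space_null_law)
  ultimately show ?thesis
    by (simp add: p_miss_def E_def P.emeasure_eq_measure)
qed

section \<open>Testing against a law with small second moment\<close>

text \<open>With \<open>l\<close> the likelihood ratio, the error sum of the test with rejection region
  \<open>A\<close> is \<open>1\<close> minus the expectation of \<open>indicator A * (l - 1)\<close>. By
  nonnegativity of the variance, the square of that expectation is at most the expectation of
  \<open>(l - 1)\<^sup>2\<close>, which is the second moment minus \<open>1\<close>.\<close>

lemma (in prob_space) testing_error_ge_second_moment:
  assumes L [measurable]: "L \<in> borel_measurable M"
    and prob: "prob_space (density M L)"
    and second: "(\<integral>\<^sup>+x. L x * L x \<partial>M) \<le> ennreal (1 + e)" and e: "0 \<le> e"
    and A [measurable]: "A \<in> events"
  shows "1 - sqrt e \<le> prob A + measure (density M L) (space M - A)"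
proof -
  interpret D: prob_space "density M L" by (rule prob)
  have int_L: "(\<integral>\<^sup>+x. L x \<partial>M) = 1"
    using D.emeasure_space_1 by (simp add: emeasure_density)
  then have "AE x in M. L x \<noteq> \<infinity>"
    by (intro nn_integral_PInf_AE) auto
  define l where "l x = enn2real (L x)" for x
  have l_meas [measurable]: "l \<in> borel_measurable M" unfolding l_def by measurable
  have l_nonneg: "0 \<le> l x" for x by (simp add: l_def)
  have lL: "AE x in M. ennreal (l x) = L x"
    using \<open>AE x in M. L x \<noteq> \<infinity>\<close> by eventually_elim (simp add: l_def less_top)
  have nn_l: "(\<integral>\<^sup>+x. ennreal (l x) \<partial>M) = 1"
    using nn_integral_cong_AE[OF lL] int_L by simp
  have int_l [simp]: "integrable M l"
    using nn_l by (intro integrableI_nonneg) (auto simp: l_nonneg)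
  have exp_l: "expectation l = 1"
    using nn_l by (subst integral_eq_nn_integral) (auto simp: l_nonneg)
  have "AE x in M. ennreal ((l x)\<^sup>2) = L x * L x"
    using lL by eventually_elim (simp add: power2_eq_square ennreal_mult l_nonneg)
  from nn_integral_cong_AE[OF this] have nn_l2: "(\<integral>\<^sup>+x. ennreal ((l x)\<^sup>2) \<partial>M) \<le> ennreal (1 + e)"
    using second by simp
  have int_l2 [simp]: "integrable M (\<lambda>x. (l x)\<^sup>2)"
    by (intro integrableI_nonneg) (auto intro!: le_less_trans[OF nn_l2])
  have exp_l2: "expectation (\<lambda>x. (l x)\<^sup>2) \<le> 1 + e"
    using nn_l2 e nn_integral_eq_integral[OF int_l2] by (simp add: ennreal_le_iff del: ennreal_plus)
  have D_A: "measure (density M L) A = expectation (\<lambda>x. indicator A x * l x)"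
  proof -
    have "emeasure (density M L) A = (\<integral>\<^sup>+x. L x * indicator A x \<partial>M)"
      by (rule emeasure_density) auto
    also have "\<dots> = (\<integral>\<^sup>+x. ennreal (indicator A x * l x) \<partial>M)"
    proof (rule nn_integral_cong_AE)
      show "AE x in M. L x * indicator A x = ennreal (indicator A x * l x)"
        using lL by eventually_elim (auto simp: indicator_def)
    qed
    also have "\<dots> = ennreal (expectation (\<lambda>x. indicator A x * l x))"
      by (rule nn_integral_eq_integral) (auto intro!: integrable_real_mult_indicator AE_I2 simp: l_nonneg mult.commute)
    finally show ?thesis
      by (simp add: D.emeasure_eq_measure integral_nonneg_AE l_nonneg)
  qed
  define Y where "Y x = indicator A x * (l x - 1)" for x
  have int_A: "integrable M (\<lambda>x. indicator A x * l x)"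
    using integrable_real_mult_indicator[OF A int_l] by (simp add: mult.commute)
  have int_Y: "integrable M Y"
    using integrable_real_mult_indicator[OF A, of "\<lambda>x. l x - 1"] by (simp add: Y_def[abs_def] mult.commute)
  have exp_Y: "expectation Y = measure (density M L) A - prob A"
    unfolding D_A Y_def right_diff_distrib
    by (subst Bochner_Integration.integral_diff[OF int_A]) (auto simp: less_top[symmetric])
  have int_sq: "integrable M (\<lambda>x. (l x - 1)\<^sup>2)"
    by (simp add: power2_diff)
  have int_Y2: "integrable M (\<lambda>x. (Y x)\<^sup>2)"
    by (rule Bochner_Integration.integrable_bound[OF int_sq])
       (auto simp: Y_def indicator_def)
  have "(expectation Y)\<^sup>2 \<le> expectation (\<lambda>x. (Y x)\<^sup>2)"
    using variance_eq[OF int_Y int_Y2] variance_positive[of Y] by simp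
  also have "\<dots> \<le> expectation (\<lambda>x. (l x - 1)\<^sup>2)"
    by (intro integral_mono int_Y2 int_sq) (auto simp: Y_def indicator_def)
  also have "\<dots> = expectation (\<lambda>x. (l x)\<^sup>2) - 1"
    by (simp add: power2_diff exp_l prob_space)
  also have "\<dots> \<le> e" using exp_l2 by simp
  finally have "measure (density M L) A - prob A \<le> sqrt e"
    unfolding exp_Y by (rule real_le_rsqrt)
  moreover have "measure (density M L) (space M - A) = 1 - measure (density M L) A"
    using D.prob_compl[of A] by simp
  ultimately show ?thesis by simp
qed

section \<open>Overlaps of two random subsets\<close>

text \<open>Such a subset is \<open>A\<close> together with an arbitrary subset of the complement.\<close>

lemma card_subsets_containing:
  assumes V: "finite V" and A: "A \<subseteq> V" "card A \<le> K"
  shows "card {S. S \<subseteq> V \<and> card S = K \<and> A \<subseteq> S} = (card V - card A) choose (K - card A)"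
proof -
  have finA: "finite A" using A V finite_subset by blast
  have "bij_betw (\<lambda>B. A \<union> B) {B. B \<subseteq> V - A \<and> card B = K - card A} {S. S \<subseteq> V \<and> card S = K \<and> A \<subseteq> S}"
  proof (rule bij_betw_byWitness[where f'="\<lambda>S. S - A"])
    show "(\<lambda>B. A \<union> B) ` {B. B \<subseteq> V - A \<and> card B = K - card A} \<subseteq> {S. S \<subseteq> V \<and> card S = K \<and> A \<subseteq> S}"
    proof safe
      fix B assume B: "B \<subseteq> V - A" "card B = K - card A"
      have "card (A \<union> B) = card A + card B"
        using B finA V by (intro card_Un_disjoint) (auto intro: finite_subset)
      then show "card (A \<union> B) = K" using B A by simp
    qed (use A in auto)
    show "(\<lambda>S. S - A) ` {S. S \<subseteq> V \<and> card S = K \<and> A \<subseteq> S} \<subseteq> {B. B \<subseteq> V - A \<and> card B = K - card A}"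
      using finA by (auto simp: card_Diff_subset)
  qed auto
  then have "card {S. S \<subseteq> V \<and> card S = K \<and> A \<subseteq> S} = card {B. B \<subseteq> V - A \<and> card B = K - card A}"
    by (rule bij_betw_same_card[symmetric])
  also have "\<dots> = card (V - A) choose (K - card A)"
    using V by (intro n_subsets) auto
  also have "card (V - A) = card V - card A"
    by (rule card_Diff_subset[OF finA A(1)])
  finally show ?thesis .
qed

text \<open>Seen as a probability: a fixed set of \<open>a\<close> points lies inside a uniform random
  \<open>K\<close>-subset with probability at most \<open>(K / N) ^ a\<close>. Each further point contributes
  a factor \<open>(K - i) / (N - i)\<close>, which never exceeds \<open>K / N\<close>.\<close>

lemma binomial_ratio_le_power:
  assumes "a \<le> K" "K \<le> N"
  shows "real ((N - a) choose (K - a)) \<le> real (N choose K) * (real K / real N) ^ a"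
  using assms(1)
proof (induction a)
  case (Suc a)
  define n k where "n = N - Suc a" and "k = K - Suc a"
  have nk: "N - a = Suc n" "K - a = Suc k" "k \<le> n"
    using Suc.prems assms(2) by (auto simp: n_def k_def)
  have "real (Suc n) * real (n choose k) = real (Suc k) * real (Suc n choose Suc k)"
    using Suc_times_binomial_eq[of n k] by (metis mult.commute of_nat_mult)
  then have "real (n choose k) = real (Suc n choose Suc k) * (real (Suc k) / real (Suc n))"
    by (simp add: field_simps del: of_nat_Suc binomial_Suc_Suc)
  moreover have "real (Suc k) / real (Suc n) \<le> real K / real N"
  proof -
    have KN: "K = Suc k + a" "N = Suc n + a"
      using Suc.prems assms(2) by (auto simp: n_def k_def)
    have "real (Suc k) * real a \<le> real (Suc n) * real a"
      using nk(3) by (intro mult_right_mono) auto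
    then show ?thesis
      unfolding KN by (simp add: divide_simps) (simp add: algebra_simps)
  qed
  moreover have "real (Suc n choose Suc k) \<le> real (N choose K) * (real K / real N) ^ a"
    using Suc.IH Suc.prems nk by simp
  ultimately have "real (n choose k) \<le> real (N choose K) * (real K / real N) ^ a * (real K / real N)"
    by (metis mult_mono divide_nonneg_nonneg mult_nonneg_nonneg of_nat_0_le_iff zero_le_power)
  then show ?case by (simp add: n_def k_def mult_ac)
qed simp

text \<open>The generating function of the hypergeometric overlap is at most that of a binomial variable with
  \<open>K\<close> trials and success probability \<open>K / N\<close>. Writing \<open>R = (R - 1) + 1\<close> and
  expanding the power over the subsets of \<open>S \<inter> T\<close>, which needs \<open>R \<ge> 1\<close> for nonnegative
  terms, leaves only the containment probabilities of the previous lemma; the resulting sum over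
  subsets of \<open>T\<close> is again a product.\<close>

lemma sum_power_overlap_le:
  fixes R :: real
  assumes R: "1 \<le> R" and K: "K \<le> N" and T: "T \<subseteq> {1..N}" "card T = K"
  shows "(\<Sum>S | S \<subseteq> {1..N} \<and> card S = K. R ^ card (S \<inter> T))
    \<le> real (N choose K) * exp ((real K)\<^sup>2 / real N * (R - 1))"
proof -
  define F where "F = {S. S \<subseteq> {1..N} \<and> card S = K}"
  have finF: "finite F" unfolding F_def by (rule finite_subsets_of_card)
  have finT: "finite T" using T finite_subset by blast
  have expand: "R ^ card (S \<inter> T) = (\<Sum>A\<in>Pow T. if A \<subseteq> S then (R - 1) ^ card A else 0)" for S
  proof -
    have "R ^ card (S \<inter> T) = (\<Prod>x\<in>S \<inter> T. (R - 1) + 1)" by simp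
    also have "\<dots> = (\<Sum>A\<in>Pow (S \<inter> T). (R - 1) ^ card A)"
      using finT by (subst prod_add) auto
    also have "\<dots> = (\<Sum>A\<in>Pow T. if A \<subseteq> S then (R - 1) ^ card A else 0)"
      using finT by (intro sum.mono_neutral_cong_left) auto
    finally show ?thesis .
  qed
  have "(\<Sum>S\<in>F. R ^ card (S \<inter> T)) = (\<Sum>A\<in>Pow T. \<Sum>S\<in>F. if A \<subseteq> S then (R - 1) ^ card A else 0)"
    unfolding expand by (rule sum.swap)
  also have "\<dots> = (\<Sum>A\<in>Pow T. real (card {S\<in>F. A \<subseteq> S}) * (R - 1) ^ card A)"
    using finF by (simp add: sum.If_cases Int_def)
  also have "\<dots> \<le> (\<Sum>A\<in>Pow T. real (N choose K) * ((R - 1) * (real K / real N)) ^ card A)"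
  proof (rule sum_mono)
    fix A assume A: "A \<in> Pow T"
    then have cA: "card A \<le> K" using T finT card_mono by auto
    have "{S\<in>F. A \<subseteq> S} = {S. S \<subseteq> {1..N} \<and> card S = K \<and> A \<subseteq> S}" by (auto simp: F_def)
    then have "real (card {S\<in>F. A \<subseteq> S}) = real ((N - card A) choose (K - card A))"
      using A T cA by (subst card_subsets_containing[symmetric, where V="{1..N}", simplified]) auto
    also have "\<dots> \<le> real (N choose K) * (real K / real N) ^ card A"
      by (rule binomial_ratio_le_power[OF cA K])
    finally have "real (card {S\<in>F. A \<subseteq> S}) * (R - 1) ^ card A
        \<le> real (N choose K) * (real K / real N) ^ card A * (R - 1) ^ card A"
      by (rule mult_right_mono) (use R in simp)
    then show "real (card {S\<in>F. A \<subseteq> S}) * (R - 1) ^ card A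
        \<le> real (N choose K) * ((R - 1) * (real K / real N)) ^ card A"
      by (simp only: power_mult_distrib mult_ac)
  qed
  also have "\<dots> = real (N choose K) * (\<Sum>A\<in>Pow T. ((R - 1) * (real K / real N)) ^ card A)"
    by (simp add: sum_distrib_left)
  also have "(\<Sum>A\<in>Pow T. ((R - 1) * (real K / real N)) ^ card A) = (\<Prod>x\<in>T. (R - 1) * (real K / real N) + 1)"
    using finT by (subst prod_add) auto
  also have "\<dots> = ((R - 1) * (real K / real N) + 1) ^ K" by (simp add: T)
  also have "\<dots> \<le> exp ((R - 1) * (real K / real N)) ^ K"
    using R exp_ge_add_one_self[of "(R - 1) * (real K / real N)"]
    by (intro power_mono) (auto simp: add.commute)
  also have "\<dots> = exp ((real K)\<^sup>2 / real N * (R - 1))"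
    by (simp add: exp_of_nat_mult[symmetric] power2_eq_square mult_ac)
  finally show ?thesis by (simp add: F_def mult_left_mono)
qed

section \<open>The second moment of the likelihood ratio\<close>

text \<open>The correlation, under the uniform law, of two von Mises likelihood ratios; in closed form it is
  \<open>bessel_I0 (2 * \<kappa> * cos ((\<Theta> - \<Theta>') / 2)) / (bessel_I0 \<kappa>)\<^sup>2\<close>, but only its maximum
  and its mean over \<open>\<Theta>'\<close> matter.\<close>

definition phase_overlap :: "real \<Rightarrow> real \<Rightarrow> real \<Rightarrow> ennreal" where
  "phase_overlap \<kappa> \<Theta> \<Theta>' =
    (\<integral>\<^sup>+x. ennreal (von_mises_lr \<kappa> \<Theta> x) * ennreal (von_mises_lr \<kappa> \<Theta>' x) \<partial>uniform_angle)"

lemma bessel_ratio_pos: "0 < bessel_ratio \<kappa>"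
  unfolding bessel_ratio_def by (intro divide_pos_pos zero_less_power bessel_I0_pos)

text \<open>Squaring doubles the concentration parameter; the change of normalising constant is the Bessel
  ratio. This is where that ratio enters the converse.\<close>

lemma von_mises_lr_square: "(von_mises_lr \<kappa> \<Theta> x)\<^sup>2 = bessel_ratio \<kappa> * von_mises_lr (2 * \<kappa>) \<Theta> x"
  using bessel_I0_pos[of "2 * \<kappa>"]
  by (simp add: von_mises_lr_def bessel_ratio_def power_divide exp_double[symmetric] mult.assoc)

lemma measurable_phase_overlap [measurable]: "phase_overlap \<kappa> \<Theta> \<in> borel_measurable borel"
  unfolding phase_overlap_def by measurable

text \<open>The inequality \<open>a * b \<le> (a\<^sup>2 + b\<^sup>2) / 2\<close> reduces the claim to equal phases.\<close>

lemma phase_overlap_le: "phase_overlap \<kappa> \<Theta> \<Theta>' \<le> ennreal (bessel_ratio \<kappa>)"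
proof -
  define r where "r = bessel_ratio \<kappa> / 2"
  have r: "0 \<le> r" using bessel_ratio_pos[of \<kappa>] by (simp add: r_def)
  have "phase_overlap \<kappa> \<Theta> \<Theta>'
      \<le> (\<integral>\<^sup>+x. ennreal r * ennreal (von_mises_lr (2 * \<kappa>) \<Theta> x)
          + ennreal r * ennreal (von_mises_lr (2 * \<kappa>) \<Theta>' x) \<partial>uniform_angle)"
    unfolding phase_overlap_def
  proof (intro nn_integral_mono)
    fix x
    have "von_mises_lr \<kappa> \<Theta> x * von_mises_lr \<kappa> \<Theta>' x
        \<le> ((von_mises_lr \<kappa> \<Theta> x)\<^sup>2 + (von_mises_lr \<kappa> \<Theta>' x)\<^sup>2) / 2"
      using sum_squares_bound[of "von_mises_lr \<kappa> \<Theta> x" "von_mises_lr \<kappa> \<Theta>' x"] by simp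
    also have "\<dots> = r * von_mises_lr (2 * \<kappa>) \<Theta> x + r * von_mises_lr (2 * \<kappa>) \<Theta>' x"
      by (simp add: von_mises_lr_square r_def)
    finally show "ennreal (von_mises_lr \<kappa> \<Theta> x) * ennreal (von_mises_lr \<kappa> \<Theta>' x)
        \<le> ennreal r * ennreal (von_mises_lr (2 * \<kappa>) \<Theta> x) + ennreal r * ennreal (von_mises_lr (2 * \<kappa>) \<Theta>' x)"
      using r by (simp add: ennreal_mult[symmetric] ennreal_plus[symmetric] del: ennreal_plus)
  qed
  also have "\<dots> = ennreal r + ennreal r"
    by (simp add: nn_integral_add nn_integral_cmult nn_integral_von_mises_lr)
  also have "\<dots> = ennreal (bessel_ratio \<kappa>)"
    using r by (simp add: r_def ennreal_plus[symmetric] del: ennreal_plus)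
  finally show ?thesis .
qed

lemma nn_integral_phase_overlap: "(\<integral>\<^sup>+\<Theta>'. phase_overlap \<kappa> \<Theta> \<Theta>' \<partial>uniform_angle) = 1"
proof -
  interpret UU: pair_sigma_finite uniform_angle uniform_angle ..
  have "(\<integral>\<^sup>+\<Theta>'. phase_overlap \<kappa> \<Theta> \<Theta>' \<partial>uniform_angle)
      = (\<integral>\<^sup>+x. (\<integral>\<^sup>+\<Theta>'. ennreal (von_mises_lr \<kappa> \<Theta> x) * ennreal (von_mises_lr \<kappa> \<Theta>' x) \<partial>uniform_angle) \<partial>uniform_angle)"
    unfolding phase_overlap_def by (rule UU.Fubini') measurable
  also have "\<dots> = (\<integral>\<^sup>+x. ennreal (von_mises_lr \<kappa> \<Theta> x) \<partial>uniform_angle)"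
  proof (rule nn_integral_cong)
    fix x
    have "(\<integral>\<^sup>+\<Theta>'. ennreal (von_mises_lr \<kappa> \<Theta>' x) \<partial>uniform_angle) = 1"
      by (subst von_mises_lr_sym) (rule nn_integral_von_mises_lr)
    then show "(\<integral>\<^sup>+\<Theta>'. ennreal (von_mises_lr \<kappa> \<Theta> x) * ennreal (von_mises_lr \<kappa> \<Theta>' x) \<partial>uniform_angle)
        = ennreal (von_mises_lr \<kappa> \<Theta> x)"
      by (subst nn_integral_cmult) auto
  qed
  also have "\<dots> = 1" by (rule nn_integral_von_mises_lr)
  finally show ?thesis .
qed

text \<open>The Bessel ratio bounds the phase overlap, whose mean is \<open>1\<close>.\<close>

lemma bessel_ratio_ge_1: "1 \<le> bessel_ratio \<kappa>"
proof -
  have "(\<integral>\<^sup>+\<Theta>'. phase_overlap \<kappa> 0 \<Theta>' \<partial>uniform_angle) \<le> (\<integral>\<^sup>+\<Theta>'. ennreal (bessel_ratio \<kappa>) \<partial>uniform_angle)"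
    by (intro nn_integral_mono phase_overlap_le)
  then have "ennreal 1 \<le> ennreal (bessel_ratio \<kappa>)"
    using U.emeasure_space_1 by (simp add: nn_integral_phase_overlap)
  then show ?thesis
    using bessel_ratio_pos[of \<kappa>] by (subst (asm) ennreal_le_iff) auto
qed

text \<open>For \<open>m \<ge> 1\<close>, one factor is kept to be averaged to \<open>1\<close> and the other
  \<open>m - 1\<close> are bounded by the maximum. The unknown phase thus saves one factor of the Bessel
  ratio, which becomes the term \<open>- ln (bessel_ratio \<kappa>)\<close> of the converse. The summand
  \<open>1\<close> covers \<open>m = 0\<close>.\<close>

lemma nn_integral_phase_overlap_power_le:
  "(\<integral>\<^sup>+\<Theta>'. phase_overlap \<kappa> \<Theta> \<Theta>' ^ m \<partial>uniform_angle) \<le> ennreal (1 + bessel_ratio \<kappa> ^ m / bessel_ratio \<kappa>)"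
proof (cases m)
  case 0
  then show ?thesis
    using U.emeasure_space_1 bessel_ratio_pos[of \<kappa>] by (simp add: le_iff_add ennreal_plus)
next
  case (Suc j)
  have "(\<integral>\<^sup>+\<Theta>'. phase_overlap \<kappa> \<Theta> \<Theta>' ^ m \<partial>uniform_angle)
      \<le> (\<integral>\<^sup>+\<Theta>'. ennreal (bessel_ratio \<kappa>) ^ j * phase_overlap \<kappa> \<Theta> \<Theta>' \<partial>uniform_angle)"
    unfolding Suc power_Suc2 by (intro nn_integral_mono mult_right_mono power_mono phase_overlap_le) auto
  also have "\<dots> = ennreal (bessel_ratio \<kappa>) ^ j"
    by (subst nn_integral_cmult) (auto simp: nn_integral_phase_overlap)
  also have "\<dots> \<le> ennreal (1 + bessel_ratio \<kappa> ^ m / bessel_ratio \<kappa>)"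
    using bessel_ratio_pos[of \<kappa>] by (simp add: Suc ennreal_power ennreal_leI)
  finally show ?thesis .
qed

text \<open>Coordinates in exactly one of the two subsets integrate a density and give \<open>1\<close>; each
  shared coordinate gives one phase overlap.\<close>

lemma nn_integral_planted_lr_product:
  assumes S: "S \<subseteq> {1..N}"
  shows "(\<integral>\<^sup>+X. ennreal (planted_lr N \<kappa> S \<Theta> X) * ennreal (planted_lr N \<kappa> S' \<Theta>' X) \<partial>null_law N)
    = phase_overlap \<kappa> \<Theta> \<Theta>' ^ card (S' \<inter> S)"
proof -
  interpret Q: product_sigma_finite "\<lambda>_::nat. uniform_angle"
    by (rule product_sigma_finite_uniform_angle)
  define f where "f i x = (if i \<in> S then von_mises_lr \<kappa> \<Theta> x else 1)" for i :: nat and x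
  define f' where "f' i x = (if i \<in> S' then von_mises_lr \<kappa> \<Theta>' x else 1)" for i :: nat and x
  have [measurable]: "f i \<in> borel_measurable borel" "f' i \<in> borel_measurable borel" for i
    unfolding f_def f'_def by simp_all
  have f: "ennreal (planted_lr N \<kappa> S \<Theta> X) = (\<Prod>i\<in>{1..N}. ennreal (f i (X i)))" for X
    unfolding planted_lr_def f_def by (subst prod_ennreal) auto
  have f': "ennreal (planted_lr N \<kappa> S' \<Theta>' X) = (\<Prod>i\<in>{1..N}. ennreal (f' i (X i)))" for X
    unfolding planted_lr_def f'_def by (subst prod_ennreal) auto
  have coord: "(\<integral>\<^sup>+x. ennreal (f i x) * ennreal (f' i x) \<partial>uniform_angle)
      = (if i \<in> S' \<inter> S then phase_overlap \<kappa> \<Theta> \<Theta>' else 1)" for i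
    using U.emeasure_space_1
    by (cases "i \<in> S"; cases "i \<in> S'")
       (simp_all add: f_def f'_def phase_overlap_def nn_integral_von_mises_lr)
  have "(\<integral>\<^sup>+X. ennreal (planted_lr N \<kappa> S \<Theta> X) * ennreal (planted_lr N \<kappa> S' \<Theta>' X) \<partial>null_law N)
      = (\<integral>\<^sup>+X. (\<Prod>i\<in>{1..N}. ennreal (f i (X i)) * ennreal (f' i (X i))) \<partial>null_law N)"
    by (simp only: f f' prod.distrib)
  also have "\<dots> = (\<Prod>i\<in>{1..N}. \<integral>\<^sup>+x. ennreal (f i x) * ennreal (f' i x) \<partial>uniform_angle)"
    unfolding null_law_def by (rule Q.product_nn_integral_prod) auto
  also have "\<dots> = (\<Prod>i\<in>{1..N}. if i \<in> S' \<inter> S then phase_overlap \<kappa> \<Theta> \<Theta>' else 1)"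
    by (simp only: coord)
  also have "\<dots> = (\<Prod>i\<in>S' \<inter> S. phase_overlap \<kappa> \<Theta> \<Theta>')"
    using S by (intro prod.mono_neutral_cong_right) auto
  also have "\<dots> = phase_overlap \<kappa> \<Theta> \<Theta>' ^ card (S' \<inter> S)" by simp
  finally show ?thesis .
qed

text \<open>The square of an average is a double average over two independent copies of the latent variables.\<close>

lemma nn_integral_mixture_lr_square:
  "(\<integral>\<^sup>+X. mixture_lr N K \<kappa> X * mixture_lr N K \<kappa> X \<partial>null_law N)
    = (\<integral>\<^sup>+z. \<integral>\<^sup>+z'. \<integral>\<^sup>+X. ennreal (planted_lr N \<kappa> (fst z) (snd z) X) * ennreal (planted_lr N \<kappa> (fst z') (snd z') X)
        \<partial>null_law N \<partial>latent_prior N K \<partial>latent_prior N K)"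
proof -
  interpret L: prob_space "latent_prior N K" by (rule prob_space_latent_prior)
  interpret Q: prob_space "null_law N" by (rule prob_space_null_law)
  interpret LQ: pair_sigma_finite "latent_prior N K" "null_law N" ..
  define h where "h X z = ennreal (planted_lr N \<kappa> (fst z) (snd z) X)" for X and z :: "nat set \<times> real"
  have h_meas [measurable]: "(\<lambda>w. h (f w) (g w)) \<in> borel_measurable M"
    if f: "f \<in> M \<rightarrow>\<^sub>M null_law N" and g: "g \<in> M \<rightarrow>\<^sub>M latent_prior N K" for f g and M :: "'w measure"
  proof -
    have [measurable]: "f \<in> M \<rightarrow>\<^sub>M Pi\<^sub>M {1..N} (\<lambda>_. borel)" "g \<in> M \<rightarrow>\<^sub>M count_space UNIV \<Otimes>\<^sub>M borel"
      using f g unfolding measurable_cong_sets[OF refl sets_null_law]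
        measurable_cong_sets[OF refl sets_latent_prior] .
    show ?thesis unfolding h_def by measurable
  qed
  have mix: "mixture_lr N K \<kappa> X = (\<integral>\<^sup>+z. h X z \<partial>latent_prior N K)" for X
    by (simp add: mixture_lr_def h_def case_prod_beta')
  have "(\<integral>\<^sup>+X. mixture_lr N K \<kappa> X * mixture_lr N K \<kappa> X \<partial>null_law N)
      = (\<integral>\<^sup>+X. \<integral>\<^sup>+z. h X z * (\<integral>\<^sup>+z'. h X z' \<partial>latent_prior N K) \<partial>latent_prior N K \<partial>null_law N)"
    unfolding mix by (intro nn_integral_cong nn_integral_multc[symmetric]) measurable
  also have "\<dots> = (\<integral>\<^sup>+z. \<integral>\<^sup>+X. h X z * (\<integral>\<^sup>+z'. h X z' \<partial>latent_prior N K) \<partial>null_law N \<partial>latent_prior N K)"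
    by (rule LQ.Fubini') measurable
  also have "\<dots> = (\<integral>\<^sup>+z. \<integral>\<^sup>+X. \<integral>\<^sup>+z'. h X z * h X z' \<partial>latent_prior N K \<partial>null_law N \<partial>latent_prior N K)"
    by (intro nn_integral_cong nn_integral_cmult[symmetric]) measurable
  also have "\<dots> = (\<integral>\<^sup>+z. \<integral>\<^sup>+z'. \<integral>\<^sup>+X. h X z * h X z' \<partial>null_law N \<partial>latent_prior N K \<partial>latent_prior N K)"
    by (intro nn_integral_cong LQ.Fubini') measurable
  finally show ?thesis by (simp only: h_def)
qed

lemma second_moment_mixture_lr_le:
  assumes K: "K \<le> N"
  shows "(\<integral>\<^sup>+X. mixture_lr N K \<kappa> X * mixture_lr N K \<kappa> X \<partial>null_law N)
    \<le> ennreal (1 + exp ((real K)\<^sup>2 / real N * (bessel_ratio \<kappa> - 1) - ln (bessel_ratio \<kappa>)))"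
    (is "_ \<le> ennreal ?B")
proof -
  interpret L: prob_space "latent_prior N K" by (rule prob_space_latent_prior)
  interpret Q: prob_space "null_law N" by (rule prob_space_null_law)
  define R where "R = bessel_ratio \<kappa>"
  have R: "1 \<le> R" unfolding R_def by (rule bessel_ratio_ge_1)
  define F where "F = {S. S \<subseteq> {1..N} \<and> card S = K}"
  have finF: "finite F" and F_ne: "F \<noteq> {}"
    unfolding F_def using finite_subsets_of_card subsets_of_card_nonempty[OF K] by blast+
  have card_F: "card F = N choose K"
    unfolding F_def using n_subsets[of "{1..N}" K] by simp
  have F_pos: "0 < real (N choose K)" using K by simp
  define C where "C z z' = (\<integral>\<^sup>+X. ennreal (planted_lr N \<kappa> (fst z) (snd z) X)
      * ennreal (planted_lr N \<kappa> (fst z') (snd z') X) \<partial>null_law N)" for z z' :: "nat set \<times> real"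
  have inner: "(\<integral>\<^sup>+z'. C (S, \<Theta>) z' \<partial>latent_prior N K) \<le> ennreal ?B" if S: "S \<in> F" for S \<Theta>
  proof -
    have S': "S \<subseteq> {1..N}" "card S = K" using S by (auto simp: F_def)
    have "(\<integral>\<^sup>+z'. C (S, \<Theta>) z' \<partial>latent_prior N K)
        = (\<integral>\<^sup>+S'. (\<integral>\<^sup>+\<Theta>'. C (S, \<Theta>) (S', \<Theta>') \<partial>uniform_angle) \<partial>measure_pmf (pmf_of_set F))"
      unfolding F_def C_def by (rule nn_integral_latent_prior) measurable
    also have "\<dots> = (\<integral>\<^sup>+S'. (\<integral>\<^sup>+\<Theta>'. phase_overlap \<kappa> \<Theta> \<Theta>' ^ card (S' \<inter> S) \<partial>uniform_angle) \<partial>measure_pmf (pmf_of_set F))"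
      by (simp only: C_def fst_conv snd_conv nn_integral_planted_lr_product[OF S'(1)])
    also have "\<dots> \<le> (\<integral>\<^sup>+S'. ennreal (1 + R ^ card (S' \<inter> S) / R) \<partial>measure_pmf (pmf_of_set F))"
      unfolding R_def by (intro nn_integral_mono nn_integral_phase_overlap_power_le)
    also have "\<dots> = (\<Sum>S'\<in>F. ennreal (1 + R ^ card (S' \<inter> S) / R)) / ennreal (card F)"
      using finF F_ne by (simp add: nn_integral_pmf_of_set ennreal_of_nat_eq_real_of_nat)
    also have "\<dots> = ennreal ((\<Sum>S'\<in>F. 1 + R ^ card (S' \<inter> S) / R) / real (card F))"
      using R F_pos by (subst sum_ennreal) (auto intro!: divide_ennreal sum_nonneg simp: card_F)
    also have "(\<Sum>S'\<in>F. 1 + R ^ card (S' \<inter> S) / R) / real (card F)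
        = 1 + (\<Sum>S'\<in>F. R ^ card (S' \<inter> S)) / real (N choose K) / R"
      using F_pos R by (simp add: sum.distrib sum_divide_distrib[symmetric] card_F field_simps)
    also have "\<dots> \<le> 1 + exp ((real K)\<^sup>2 / real N * (R - 1)) / R"
      using sum_power_overlap_le[OF R K S'] F_pos R
      by (auto simp: F_def pos_divide_le_eq mult.commute intro!: divide_right_mono)
    also have "\<dots> = ?B"
      using R by (simp add: exp_diff R_def)
    finally show ?thesis by (simp add: ennreal_leI)
  qed
  have "(\<integral>\<^sup>+X. mixture_lr N K \<kappa> X * mixture_lr N K \<kappa> X \<partial>null_law N)
      = (\<integral>\<^sup>+z. \<integral>\<^sup>+z'. C z z' \<partial>latent_prior N K \<partial>latent_prior N K)"
    unfolding C_def by (rule nn_integral_mixture_lr_square)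
  also have "\<dots> = (\<integral>\<^sup>+S. (\<integral>\<^sup>+\<Theta>. (\<integral>\<^sup>+z'. C (S, \<Theta>) z' \<partial>latent_prior N K) \<partial>uniform_angle) \<partial>measure_pmf (pmf_of_set F))"
    unfolding F_def C_def by (rule nn_integral_latent_prior) measurable
  also have "\<dots> \<le> (\<integral>\<^sup>+S. (\<integral>\<^sup>+\<Theta>. ennreal ?B \<partial>uniform_angle) \<partial>measure_pmf (pmf_of_set F))"
    using finF F_ne by (intro nn_integral_mono_AE AE_pmfI nn_integral_mono inner) auto
  also have "\<dots> = ennreal ?B"
    using U.emeasure_space_1 by simp
  finally show ?thesis .
qed

text \<open>This holds for every finite \<open>N\<close>; the converse only adds that the exponent tends to
  \<open>- \<infinity>\<close>.\<close>

lemma total_error_ge: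
  assumes K: "K \<le> N" and \<phi>: "is_test N \<phi>"
  shows "1 - sqrt (exp ((real K)\<^sup>2 / real N * (bessel_ratio \<kappa> - 1) - ln (bessel_ratio \<kappa>)))
    \<le> p_fa N \<phi> + p_miss N K \<kappa> \<phi>"
proof -
  interpret Q: prob_space "null_law N" by (rule prob_space_null_law)
  define A where "A = {X \<in> space (null_law N). \<phi> X}"
  have [measurable]: "Measurable.pred (null_law N) \<phi>"
    using \<phi> unfolding is_test_def measurable_cong_sets[OF sets_null_law refl] .
  have A: "A \<in> sets (null_law N)" unfolding A_def by measurable
  have compl: "space (null_law N) - A = {X \<in> space (planted_law N K \<kappa>). \<not> \<phi> X}"
    by (auto simp: A_def space_planted_law)
  have "prob_space (density (null_law N) (mixture_lr N K \<kappa>))"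
    unfolding planted_law_density[symmetric] by (rule prob_space_planted_law)
  from Q.testing_error_ge_second_moment[OF measurable_mixture_lr this second_moment_mixture_lr_le[OF K] _ A]
  show ?thesis
    unfolding planted_law_density[symmetric] compl
    by (simp add: p_fa_def p_miss_def A_def)
qed

section \<open>The detection thresholds\<close>

text \<open>The Chernoff bound is available for the \<open>N - 1\<close> angles other than the anchor, with mean
  \<open>\<mu> = (N - 1) * \<tau>\<close> and excess \<open>t\<close>, whereas the detection condition is written with
  mean \<open>N * \<tau>\<close> and excess \<open>t + (1 - \<tau>)\<close>. The exponents differ by a bounded amount,
  because \<open>2 * t * (1 - \<tau>)\<close> is at most twice the denominator.\<close>

lemma chernoff_exponent_shift_le:
  fixes \<mu> t \<tau> :: real
  assumes "0 < \<mu>" "0 \<le> t" "0 < \<tau>" "\<tau> < 1"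
  shows "(t + (1 - \<tau>))\<^sup>2 / (2 * (\<mu> + \<tau>) + (t + (1 - \<tau>))) \<le> t\<^sup>2 / (2 * \<mu> + t) + 3"
proof -
  define D where "D = 2 * \<mu> + t"
  define s where "s = 1 - \<tau>"
  have D: "0 < D" "t \<le> D" and s: "0 \<le> s" "s \<le> 1" using assms by (simp_all add: D_def s_def)
  have "t * s \<le> t * 1" using assms s by (intro mult_left_mono) auto
  moreover have "s\<^sup>2 \<le> 1" using s by (simp add: power_le_one)
  ultimately have "(t + s)\<^sup>2 \<le> t\<^sup>2 + 3 * D + 3"
    using D assms by (simp add: power2_sum)
  also have "\<dots> \<le> t\<^sup>2 + 3 * D + 3 + (t\<^sup>2 / D * (1 + \<tau>) + 3 * \<tau>)"
    using D assms by simp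
  also have "\<dots> = (t\<^sup>2 / D + 3) * (D + (1 + \<tau>))"
    using D by (simp add: field_simps)
  finally have "(t + s)\<^sup>2 / (D + (1 + \<tau>)) \<le> t\<^sup>2 / D + 3"
    using D assms by (simp add: pos_divide_le_eq)
  moreover have "2 * (\<mu> + \<tau>) + (t + s) = D + (1 + \<tau>)" by (simp add: D_def s_def)
  ultimately show ?thesis by (simp only: D_def s_def)
qed

lemma p_fa_interval_test_le_exp:
  assumes N: "2 \<le> N" and \<tau>: "0 < \<tau>" "\<tau> < 1" and \<gamma>: "1 + (real N - 1) * \<tau> \<le> \<gamma>"
    and x: "\<gamma> = real N * \<tau> + x"
  shows "p_fa N (interval_test N \<tau> \<gamma>) \<le> exp (3 - (x\<^sup>2 / (2 * real N * \<tau> + x) - ln (real N)))"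
proof -
  define \<mu> t where "\<mu> = (real N - 1) * \<tau>" and "t = \<gamma> - 1 - (real N - 1) * \<tau>"
  have \<mu>: "0 < \<mu>" using N \<tau> by (simp add: \<mu>_def)
  have t: "0 \<le> t" using \<gamma> by (simp add: t_def)
  have xt: "t + (1 - \<tau>) = x" "2 * (\<mu> + \<tau>) = 2 * real N * \<tau>"
    by (simp_all add: t_def \<mu>_def x algebra_simps)
  have "x\<^sup>2 / (2 * real N * \<tau> + x) \<le> t\<^sup>2 / (2 * \<mu> + t) + 3"
    using chernoff_exponent_shift_le[OF \<mu> t \<tau>] unfolding xt .
  then have "ln (real N) - t\<^sup>2 / (2 * \<mu> + t) \<le> 3 - (x\<^sup>2 / (2 * real N * \<tau> + x) - ln (real N))"
    by simp
  moreover have "p_fa N (interval_test N \<tau> \<gamma>) \<le> exp (ln (real N) - t\<^sup>2 / (2 * \<mu> + t))"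
    using p_fa_interval_test_le[OF N \<tau> \<gamma>] N by (simp add: \<mu>_def t_def exp_diff exp_minus field_simps)
  ultimately show ?thesis by (meson exp_le_cancel_iff order_trans)
qed

theorem theorem2:
  fixes K :: "nat \<Rightarrow> nat" and \<kappa> :: "nat \<Rightarrow> real"
  assumes K: "\<forall>N\<ge>1. 1 \<le> K N \<and> K N \<le> N"
    and \<kappa>: "\<forall>N\<ge>1. 0 < \<kappa> N"
  shows
    "(\<forall>(\<tau> :: nat \<Rightarrow> real) (g :: nat \<Rightarrow> real) (c :: nat \<Rightarrow> real) (\<gamma> :: nat \<Rightarrow> real).
        (\<forall>N\<ge>1. 0 < \<tau> N \<and> \<tau> N < 1) \<longrightarrow>
        (\<forall>N\<ge>1. g N = real (K N) * (arc_prob (\<kappa> N) (\<tau> N) - \<tau> N)) \<longrightarrow>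
        filterlim c at_top sequentially \<longrightarrow>
        (\<forall>N\<ge>1. \<gamma> N = real N * \<tau> N + g N - c N * sqrt (real N * \<tau> N + g N)) \<longrightarrow>
        (\<forall>\<^sub>F N in sequentially. \<gamma> N \<ge> 1 + (real N - 1) * \<tau> N) \<longrightarrow>
        filterlim (\<lambda>N. (g N)\<^sup>2 / (real N * \<tau> N + g N)) at_top sequentially \<longrightarrow>
        filterlim (\<lambda>N. (g N - c N * sqrt (real N * \<tau> N + g N))\<^sup>2 /
                         (2 * real N * \<tau> N + g N - c N * sqrt (real N * \<tau> N + g N))
                       - ln (real N)) at_top sequentially \<longrightarrow>
        strong_detection K \<kappa> (\<lambda>N. interval_test N (\<tau> N) (\<gamma> N)))
     \<and>
     (filterlim (\<lambda>N. (real (K N))\<^sup>2 / real N * (bessel_ratio (\<kappa> N) - 1)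
                     - ln (bessel_ratio (\<kappa> N))) at_bot sequentially \<longrightarrow>
        weak_detection_impossible K \<kappa>)"
proof (intro conjI allI impI)
  fix \<tau> g c \<gamma> :: "nat \<Rightarrow> real"
  assume \<tau>: "\<forall>N\<ge>1. 0 < \<tau> N \<and> \<tau> N < 1"
    and g: "\<forall>N\<ge>1. g N = real (K N) * (arc_prob (\<kappa> N) (\<tau> N) - \<tau> N)"
    and c: "filterlim c at_top sequentially"
    and \<gamma>: "\<forall>N\<ge>1. \<gamma> N = real N * \<tau> N + g N - c N * sqrt (real N * \<tau> N + g N)"
    and \<gamma>_large: "\<forall>\<^sub>F N in sequentially. \<gamma> N \<ge> 1 + (real N - 1) * \<tau> N"
    and snr: "filterlim (\<lambda>N. (g N)\<^sup>2 / (real N * \<tau> N + g N)) at_top sequentially"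
    and exponent: "filterlim (\<lambda>N. (g N - c N * sqrt (real N * \<tau> N + g N))\<^sup>2 /
        (2 * real N * \<tau> N + g N - c N * sqrt (real N * \<tau> N + g N)) - ln (real N)) at_top sequentially"
  define m x E where "m N = real N * \<tau> N + g N" and "x N = g N - c N * sqrt (m N)"
    and "E N = (x N)\<^sup>2 / (2 * real N * \<tau> N + x N) - ln (real N)" for N
  have E_lim: "filterlim E at_top sequentially"
    using exponent by (simp add: E_def[abs_def] x_def m_def add_diff_eq)
  have fa_bound: "\<forall>\<^sub>F N in sequentially. p_fa N (interval_test N (\<tau> N) (\<gamma> N)) \<le> exp (3 - E N)"
    using \<gamma>_large eventually_ge_at_top[of 2]
  proof eventually_elim
    case (elim N)
    have "\<gamma> N = real N * \<tau> N + x N" using \<gamma> elim by (simp add: x_def m_def)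
    with p_fa_interval_test_le_exp[of N "\<tau> N" "\<gamma> N" "x N"] \<tau> elim show ?case
      by (simp add: E_def)
  qed
  have fa_lim: "(\<lambda>N. exp (3 - E N)) \<longlonglongrightarrow> 0"
  proof (rule filterlim_compose[OF exp_at_bot])
    show "filterlim (\<lambda>N. 3 - E N) at_bot sequentially"
      unfolding filterlim_uminus_at_bot
      using filterlim_tendsto_add_at_top[OF tendsto_const[of "-3"] E_lim] by simp
  qed
  have miss_bound: "\<forall>\<^sub>F N in sequentially.
      p_miss N (K N) (\<kappa> N) (interval_test N (\<tau> N) (\<gamma> N)) \<le> exp (- ((c N)\<^sup>2 / 2))"
    using eventually_ge_at_top[of 1] filterlim_at_top_dense[THEN iffD1, OF snr, rule_format, of 0]
      filterlim_at_top_dense[THEN iffD1, OF c, rule_format, of 0]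
  proof eventually_elim
    case (elim N)
    \<comment> \<open>for \<open>m N = 0\<close> the quotient by zero would vanish, so divergence of the signal-to-noise
      ratio also excludes this case\<close>
    have m_pos: "0 < m N"
    proof (rule ccontr)
      assume "\<not> 0 < m N"
      then have "(g N)\<^sup>2 / m N \<le> 0" by (intro divide_nonneg_nonpos) auto
      with elim(2) show False by (simp add: m_def)
    qed
    have "p_miss N (K N) (\<kappa> N) (interval_test N (\<tau> N) (m N - c N * sqrt (m N)))
        \<le> exp (- ((c N * sqrt (m N))\<^sup>2 / (2 * m N)))"
      using K \<tau> g elim m_pos by (intro p_miss_interval_test_le) (auto simp: m_def)
    also have "(c N * sqrt (m N))\<^sup>2 / (2 * m N) = (c N)\<^sup>2 / 2"
      using m_pos by (simp add: power_mult_distrib)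
    also have "m N - c N * sqrt (m N) = \<gamma> N"
      using \<gamma> elim by (simp add: m_def)
    finally show ?case .
  qed
  have miss_lim: "(\<lambda>N. exp (- ((c N)\<^sup>2 / 2))) \<longlonglongrightarrow> 0"
  proof (rule filterlim_compose[OF exp_at_bot])
    have "filterlim (\<lambda>N. (1/2) * (c N)\<^sup>2) at_top sequentially"
      by (intro filterlim_tendsto_pos_mult_at_top[OF tendsto_const] filterlim_pow_at_top c) auto
    then show "filterlim (\<lambda>N. - ((c N)\<^sup>2 / 2)) at_bot sequentially"
      unfolding filterlim_uminus_at_bot by simp
  qed
  show "strong_detection K \<kappa> (\<lambda>N. interval_test N (\<tau> N) (\<gamma> N))"
    unfolding strong_detection_def
  proof (intro conjI allI impI is_test_interval_test)
    show "(\<lambda>N. p_fa N (interval_test N (\<tau> N) (\<gamma> N))) \<longlonglongrightarrow> 0"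
      by (rule tendsto_sandwich[OF _ fa_bound tendsto_const fa_lim]) (simp add: p_fa_def)
    show "(\<lambda>N. p_miss N (K N) (\<kappa> N) (interval_test N (\<tau> N) (\<gamma> N))) \<longlonglongrightarrow> 0"
      by (rule tendsto_sandwich[OF _ miss_bound tendsto_const miss_lim]) (simp add: p_miss_def)
  qed
next
  define e where "e N = (real (K N))\<^sup>2 / real N * (bessel_ratio (\<kappa> N) - 1) - ln (bessel_ratio (\<kappa> N))" for N
  assume "filterlim (\<lambda>N. (real (K N))\<^sup>2 / real N * (bessel_ratio (\<kappa> N) - 1)
      - ln (bessel_ratio (\<kappa> N))) at_bot sequentially"
  then have "filterlim e at_bot sequentially" by (simp add: e_def[abs_def])
  then have lim: "(\<lambda>N. sqrt (exp (e N))) \<longlonglongrightarrow> 0"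
    using tendsto_real_sqrt[OF filterlim_compose[OF exp_at_bot]] by simp
  show "weak_detection_impossible K \<kappa>"
    unfolding weak_detection_impossible_def
  proof (intro allI impI exI[of _ "\<lambda>N. sqrt (exp (e N))"] conjI lim)
    fix \<phi> :: "nat \<Rightarrow> (nat \<Rightarrow> real) \<Rightarrow> bool" and N :: nat
    assume "\<forall>N\<ge>1. is_test N (\<phi> N)" "1 \<le> N"
    then show "1 - sqrt (exp (e N)) \<le> p_fa N (\<phi> N) + p_miss N (K N) (\<kappa> N) (\<phi> N)"
      unfolding e_def using K by (intro total_error_ge) auto
  qed
qed

end
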